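(* Let $1<p<\infty$ and let $p'$ be the dual exponent, $\frac1p+\frac1{p'}=1$. There exist nontrivial weights $w$ and $v=\left(\frac{Mw}{w}\right)^{p}w$ on $\mathbb{R}$ for which the Hardy-Littlewood maximal operator $M$ is bounded $$M: L^p\left(\left(\tfrac{Mw}{w}\right)^{p} w\right)\to L^p(w)\quad\text{and}\quad M: L^{p'}(w^{1-p'})\to L^{p'}\left(\tfrac{w}{(Mw)^{p'}}\right),$$ but the Hilbert transform $H$ is unbounded from $L^p\left(\left(\frac{Mw}{w}\right)^{p} w\right)$ to $L^p(w)$.
   Context: A weight on $\mathbb{R}$ is a non-negative locally integrable function; it is nontrivial if it is not a.e. zero. Weights are allowed to vanish on sets of positive measure. The expressions $\left(\frac{Mw}{w}\right)^p w$, $w^{1-p'}$ and $\frac{w}{(Mw)^{p'}}$ are understood on the set $\{w>0\}$ and taken to be zero off it. For a nonnegative function $u$ on $\mathbb{R}$, $L^q(u)$ as a domain is the set of measurable functions $f$ which vanish a.e. off $\{u>0\}$ and satisfy $\|f\|_{L^q(u)}=\left(\int|f|^q u\,dx\right)^{1/q}<\infty$; for any measurable $g$, $\|g\|_{L^q(u)}=\left(\int_{\mathbb{R}} |g|^q u\,dx\right)^{1/q}$. An operator $T$ is bounded from $L^q(u_1)$ to $L^q(u_2)$ if there is a finite $C$ with $\|Tf\|_{L^q(u_2)}\le C\|f\|_{L^q(u_1)}$ for all $f\in L^q(u_1)$, and unbounded if no such $C$ exists. The Hardy-Littlewood maximal function is $Mf(x)=\sup_{Q}\frac{1_Q(x)}{|Q|}\int_Q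 |f(y)|\,dy$, the supremum being over bounded intervals $Q\subset\mathbb{R}$. The Hilbert transform is $Hf(x)=\mathrm{p.v.}\int_{\mathbb{R}}\frac{f(y)}{y-x}\,dy$. *)

theory Defs
  imports "HOL-Analysis.Analysis"
begin

definition weight :: "(real \<Rightarrow> real) \<Rightarrow> bool" where
  "weight w \<longleftrightarrow> (\<forall>x. 0 \<le> w x) \<and> (\<forall>K. compact K \<longrightarrow> set_integrable lebesgue K w)"

definition nontrivial :: "(real \<Rightarrow> real) \<Rightarrow> bool" where
  "nontrivial w \<longleftrightarrow> \<not> (AE x in lebesgue. w x = 0)"

(* Power on [0,\<infinity>]; only meaningful, and only used, for exponents r > 0. *)
definition epowr :: "ennreal \<Rightarrow> real \<Rightarrow> ennreal" where
  "epowr x r = (if x = \<infinity> then \<infinity> else ennreal (enn2real x powr r))"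

(* The norm depends only on the modulus of a function, so g stands for that modulus; this also
   admits functions, such as M f, that may take the value \<infinity>. *)
definition Lnorm :: "real \<Rightarrow> (real \<Rightarrow> ennreal) \<Rightarrow> (real \<Rightarrow> ennreal) \<Rightarrow> ennreal" where
  "Lnorm q u g = epowr (\<integral>\<^sup>+x. epowr (g x) q * u x \<partial>lebesgue) (1 / q)"

definition Ldom :: "real \<Rightarrow> (real \<Rightarrow> ennreal) \<Rightarrow> (real \<Rightarrow> real) set" where
  "Ldom q u = {f. f \<in> borel_measurable lebesgue \<and>
                  (AE x in lebesgue. \<not> 0 < u x \<longrightarrow> f x = 0) \<and>
                  Lnorm q u (\<lambda>x. ennreal \<bar>f x\<bar>) < \<infinity>}"

(* Here T f x stands for the modulus of the value at x of the operator applied to f. *)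
definition bounded_operator ::
  "((real \<Rightarrow> real) \<Rightarrow> real \<Rightarrow> ennreal) \<Rightarrow> real \<Rightarrow> (real \<Rightarrow> ennreal) \<Rightarrow> (real \<Rightarrow> ennreal) \<Rightarrow> bool" where
  "bounded_operator T q u1 u2 \<longleftrightarrow>
     (\<exists>C<\<infinity>. \<forall>f\<in>Ldom q u1. Lnorm q u2 (T f) \<le> C * Lnorm q u1 (\<lambda>x. ennreal \<bar>f x\<bar>))"

definition maximal :: "(real \<Rightarrow> real) \<Rightarrow> real \<Rightarrow> ennreal" where
  "maximal f x =
     (SUP Q \<in> {Q. is_interval Q \<and> bounded Q \<and> 0 < emeasure lebesgue Q}.
        indicator Q x / emeasure lebesgue Q * (\<integral>\<^sup>+y\<in>Q. ennreal \<bar>f y\<bar> \<partial>lebesgue))"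

definition hilbert_trunc :: "(real \<Rightarrow> real) \<Rightarrow> real \<Rightarrow> real \<Rightarrow> real" where
  "hilbert_trunc f x \<epsilon> = (LINT y:{y. \<epsilon> < \<bar>y - x\<bar>}|lebesgue. f y / (y - x))"

definition hilbert_exists :: "(real \<Rightarrow> real) \<Rightarrow> real \<Rightarrow> bool" where
  "hilbert_exists f x \<longleftrightarrow>
     (\<forall>\<epsilon>>0. set_integrable lebesgue {y. \<epsilon> < \<bar>y - x\<bar>} (\<lambda>y. f y / (y - x))) \<and>
     (\<exists>l. (hilbert_trunc f x \<longlongrightarrow> l) (at_right 0))"

(* The value is 0 where the principal value does not exist, so that such points
   contribute nothing to a norm of the transform: unboundedness can only come from points where
   the principal value exists. *)
definition hilbert :: "(real \<Rightarrow> real) \<Rightarrow> real \<Rightarrow> real" where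
  "hilbert f x = (if hilbert_exists f x then Lim (at_right 0) (hilbert_trunc f x) else 0)"

end

theory Submission
  imports Defs
begin

text \<open>
  On the line both maximal inequalities hold for every weight that is regular enough, so that the
  example only has to defeat the Hilbert transform.

  The reason is one-dimensional: a finite family of intervals can be thinned out, without changing
  its union, until no point is covered more than twice (finite_interval_subcover). An estimate that
  bounds the mass of one measure on each interval of a family by the mass of another measure
  therefore passes to the union with the factor 2. This gives a weak type bound, and then a strong
  type bound, for the averages of g against a density u (weighted_maximal_strong_type). With u = 1
  it is the inequality of Fefferman and Stein, the integral of (Mf)^p w being at most a constant
  times the integral of |f|^p Mw, and here Mw is at most v wherever w is positive. With u = w it
  bounds the maximal operator of the measure w dx; the second inequality follows because M(gw) is at
  most Mw times that operator applied to g.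

  For the Hilbert transform fix L and put N = 2L. An interval of length N^(k+1) is cut into N cells
  of length N^k. Cell 0 carries the constant density 2^-(k+1), the cells 2, ..., L+1 carry copies of
  the pattern one scale below, and the remaining cells are empty. The smallest cells of this
  hierarchy carry density 1. Each step down halves the occupied length and doubles the density, so
  that the averages at each scale are comparable with the densities found there, and the gaps keep
  each plateau away from the denser parts. Hence Mw is comparable with w on the support of w (cell_weight_average), and v is
  comparable with w.

  Now let f be the indicator of all the plateaus and look at Hf on the cells of density 1. The
  copies lie to the right of the plateau of their interval, at the distances 2, ..., L+1, so this
  plateau contributes a negative amount which adds up to a harmonic sum, about log L. The
  contributions of a plateau to the neighbouring copies nearly cancel in pairs (pairing_pair). After
  L levels the sum of Hf over the L^L cells of density 1 is at most -L^L (log L - O(1))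
  (pairing_top), whereas the mass that w puts on the plateaus is at most 2 L^L. The ratio of the norms
  of Hf and f thus grows with L. Finally, copies of the pattern for all L are placed so far from each
  other that the comparison of Mw and w survives (glued_average), and one weight serves for every L.
\<close>

section \<open>Maximal inequalities on the line\<close>

text \<open>
  In a subfamily of least cardinality with the same union no point x lies in three members: the one
  that reaches farthest to the left of x and the one that reaches farthest to the right of x cover
  any third one.
\<close>
lemma finite_interval_subcover:
  fixes I :: "(real \<times> real) set"
  assumes "finite I"
  obtains J where "J \<subseteq> I" "(\<Union>(s,t)\<in>J. {s<..<t}) = (\<Union>(s,t)\<in>I. {s<..<t})"
    "\<And>x. card {q\<in>J. x \<in> {fst q<..<snd q}} \<le> 2"
proof -
  define P where "P J \<longleftrightarrow> J \<subseteq> I \<and> (\<Union>(s,t)\<in>J. {s<..<t}) = (\<Union>(s,t)\<in>I. {s<..<t})" for J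
  have "P I" by (simp add: P_def)
  then obtain J where J: "P J" and Jmin: "\<And>J'. P J' \<Longrightarrow> card J \<le> card J'"
    using ex_has_least_nat[of P I card] by blast
  have JI: "J \<subseteq> I" and Jun: "(\<Union>(s,t)\<in>J. {s<..<t}) = (\<Union>(s,t)\<in>I. {s<..<t})"
    using J by (auto simp: P_def)
  have finJ: "finite J" using JI assms finite_subset by blast
  have "card {q\<in>J. x \<in> {fst q<..<snd q}} \<le> 2" for x
  proof (rule ccontr)
    define C where "C = {q\<in>J. x \<in> {fst q<..<snd q}}"
    assume "\<not> card {q\<in>J. x \<in> {fst q<..<snd q}} \<le> 2"
    then have cC: "card C > 2" by (simp add: C_def)
    have finC: "finite C" using finJ by (simp add: C_def)
    have neC: "C \<noteq> {}" using cC by auto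
    obtain a where a: "a \<in> C" "\<And>c. c \<in> C \<Longrightarrow> fst a \<le> fst c"
      using arg_min_if_finite(1)[OF finC neC, of fst] arg_min_if_finite(2)[OF finC neC, of fst]
      by (metis not_le)
    obtain b where b: "b \<in> C" "\<And>c. c \<in> C \<Longrightarrow> snd c \<le> snd b"
      using arg_min_if_finite(1)[OF finC neC, of "\<lambda>q. - snd q"]
        arg_min_if_finite(2)[OF finC neC, of "\<lambda>q. - snd q"]
      by (metis neg_less_iff_less not_le)
    have "card {a,b} \<le> 2" by (simp add: card_insert_if)
    then have "\<not> C \<subseteq> {a,b}" using cC card_mono[of "{a,b}" C] by auto
    then obtain c where c: "c \<in> C" "c \<noteq> a" "c \<noteq> b" by blast
    \<comment> \<open>The common point x lies in all three intervals, so those of a and b overlap.\<close>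
    have cov: "{fst c<..<snd c} \<subseteq> {fst a<..<snd a} \<union> {fst b<..<snd b}"
    proof
      fix y assume y: "y \<in> {fst c<..<snd c}"
      have "fst a \<le> fst c" "snd c \<le> snd b" using a b c by auto
      moreover have "fst b < x" "x < snd a" using a b by (auto simp: C_def)
      ultimately show "y \<in> {fst a<..<snd a} \<union> {fst b<..<snd b}" using y by (cases "y \<le> x") auto
    qed
    have ab: "a \<in> J - {c}" "b \<in> J - {c}" "c \<in> J" using a b c by (auto simp: C_def)
    have "(\<Union>(s,t)\<in>J - {c}. {s<..<t}) = (\<Union>(s,t)\<in>J. {s<..<t})"
    proof
      show "(\<Union>(s,t)\<in>J. {s<..<t}) \<subseteq> (\<Union>(s,t)\<in>J - {c}. {s<..<t})"
      proof
        fix y assume "y \<in> (\<Union>(s,t)\<in>J. {s<..<t})"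
        then obtain q where q: "q \<in> J" "y \<in> {fst q<..<snd q}" by (auto simp: case_prod_beta)
        have "\<exists>q\<in>J - {c}. y \<in> {fst q<..<snd q}"
        proof (cases "q = c")
          case True
          then have "y \<in> {fst a<..<snd a} \<or> y \<in> {fst b<..<snd b}" using cov q by blast
          then show ?thesis using ab by blast
        qed (use q in blast)
        then show "y \<in> (\<Union>(s,t)\<in>J - {c}. {s<..<t})" by (auto simp: case_prod_beta)
      qed
    qed auto
    then have "P (J - {c})" using JI Jun by (auto simp: P_def)
    from Jmin[OF this] show False using ab finJ
      by (metis card_Diff1_less not_le)
  qed
  with that JI Jun show ?thesis by blast
qed

lemma nn_integral_interval_cover_finite:
  fixes w r :: "real \<Rightarrow> ennreal"
  assumes [measurable]: "w \<in> borel_measurable lborel" "r \<in> borel_measurable lborel"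
    and fin: "finite I"
    and le: "\<And>s t. (s,t) \<in> I \<Longrightarrow>
      (\<integral>\<^sup>+x. w x * indicator {s<..<t} x \<partial>lborel) \<le> (\<integral>\<^sup>+x. r x * indicator {s<..<t} x \<partial>lborel)"
  shows "(\<integral>\<^sup>+x. w x * indicator (\<Union>(s,t)\<in>I. {s<..<t}) x \<partial>lborel) \<le> 2 * (\<integral>\<^sup>+x. r x \<partial>lborel)"
proof -
  obtain J where J: "J \<subseteq> I" "(\<Union>(s,t)\<in>J. {s<..<t}) = (\<Union>(s,t)\<in>I. {s<..<t})"
    and ov: "\<And>x. card {q\<in>J. x \<in> {fst q<..<snd q}} \<le> 2"
    using finite_interval_subcover[OF fin] by blast
  have finJ: "finite J" using J fin finite_subset by blast
  have "(\<integral>\<^sup>+x. w x * indicator (\<Union>(s,t)\<in>I. {s<..<t}) x \<partial>lborel)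
      \<le> (\<integral>\<^sup>+x. (\<Sum>q\<in>J. w x * indicator {fst q<..<snd q} x) \<partial>lborel)"
  proof (rule nn_integral_mono)
    fix x :: real
    show "w x * indicator (\<Union>(s,t)\<in>I. {s<..<t}) x \<le> (\<Sum>q\<in>J. w x * indicator {fst q<..<snd q} x)"
    proof (cases "x \<in> (\<Union>(s,t)\<in>I. {s<..<t})")
      case True
      then obtain q where q: "q \<in> J" "x \<in> {fst q<..<snd q}"
        unfolding J(2)[symmetric] by (auto simp: case_prod_beta)
      have "w x * indicator {fst q<..<snd q} x \<le> (\<Sum>q\<in>J. w x * indicator {fst q<..<snd q} x)"
        using q finJ by (intro member_le_sum) auto
      then show ?thesis using q True by simp
    qed simp
  qed
  also have "\<dots> = (\<Sum>q\<in>J. \<integral>\<^sup>+x. w x * indicator {fst q<..<snd q} x \<partial>lborel)"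
    by (rule nn_integral_sum) measurable
  also have "\<dots> \<le> (\<Sum>q\<in>J. \<integral>\<^sup>+x. r x * indicator {fst q<..<snd q} x \<partial>lborel)"
    using J(1) by (intro sum_mono le) auto
  also have "\<dots> = (\<integral>\<^sup>+x. (\<Sum>q\<in>J. r x * indicator {fst q<..<snd q} x) \<partial>lborel)"
    by (rule nn_integral_sum[symmetric]) measurable
  also have "\<dots> \<le> (\<integral>\<^sup>+x. 2 * r x \<partial>lborel)"
  proof (rule nn_integral_mono)
    fix x :: real
    have "(\<Sum>q\<in>J. indicator {fst q<..<snd q} x :: ennreal) = of_nat (card {q\<in>J. x \<in> {fst q<..<snd q}})"
      using finJ by (simp add: indicator_def sum.If_cases Int_def)
    also have "\<dots> \<le> of_nat 2" using ov[of x] by (subst of_nat_le_iff) auto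
    finally have "(\<Sum>q\<in>J. indicator {fst q<..<snd q} x :: ennreal) \<le> 2" by simp
    then show "(\<Sum>q\<in>J. r x * indicator {fst q<..<snd q} x) \<le> 2 * r x"
      by (simp add: sum_distrib_left[symmetric] mult.commute[of 2] mult_left_mono)
  qed
  also have "\<dots> = 2 * (\<integral>\<^sup>+x. r x \<partial>lborel)" by (rule nn_integral_cmult) measurable
  finally show ?thesis .
qed

text \<open>
  The finite case extends to arbitrary families, because countably many of the intervals already have
  the same union, which is then exhausted by finite unions.
\<close>
lemma nn_integral_interval_cover:
  fixes w r :: "real \<Rightarrow> ennreal"
  assumes [measurable]: "w \<in> borel_measurable lborel" "r \<in> borel_measurable lborel"
    and le: "\<And>s t. (s,t) \<in> I \<Longrightarrow>
      (\<integral>\<^sup>+x. w x * indicator {s<..<t} x \<partial>lborel) \<le> (\<integral>\<^sup>+x. r x * indicator {s<..<t} x \<partial>lborel)"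
  shows "(\<integral>\<^sup>+x. w x * indicator (\<Union>(s,t)\<in>I. {s<..<t}) x \<partial>lborel) \<le> 2 * (\<integral>\<^sup>+x. r x \<partial>lborel)"
proof -
  define iv where "iv = (\<lambda>(s,t). {s<..<t::real})"
  have op: "S \<in> iv ` I \<Longrightarrow> open S" for S by (auto simp: iv_def)
  obtain F' where F': "F' \<subseteq> iv ` I" "countable F'" "\<Union>F' = \<Union>(iv ` I)"
    using Lindelof[of "iv ` I"] op by blast
  obtain I' where I': "I' \<subseteq> I" "countable I'" "F' = iv ` I'"
    using countable_subset_image[of F' iv I] F' by blast
  have un: "(\<Union>(s,t)\<in>I. {s<..<t}) = \<Union>(iv ` I')"
    using F'(3) I'(3) unfolding iv_def by simp
  show ?thesis
  proof (cases "I' = {}")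
    case True
    then show ?thesis by (simp add: un)
  next
    case False
    then obtain q where q: "I' = range (q :: nat \<Rightarrow> _)"
      using I'(2) by (metis uncountable_def)
    define A where "A n = \<Union>(iv ` (q ` {..n}))" for n
    have Aeq: "A n = (\<Union>(s,t)\<in>q ` {..n}. {s<..<t})" for n by (simp add: A_def iv_def)
    have Aop: "open (A n)" for n unfolding Aeq by (auto simp: case_prod_beta)
    have rA: "range A \<subseteq> sets (density lborel w)" using Aop by auto
    have iA: "incseq A" unfolding incseq_def A_def by (intro allI impI Union_mono image_mono) auto
    have Aun: "(\<Union>n. A n) = (\<Union>(s,t)\<in>I. {s<..<t})"
      unfolding un q A_def by auto
    have bd: "emeasure (density lborel w) (A n) \<le> 2 * (\<integral>\<^sup>+x. r x \<partial>lborel)" for n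
    proof -
      have "emeasure (density lborel w) (A n) = (\<integral>\<^sup>+x. w x * indicator (A n) x \<partial>lborel)"
        using Aop by (intro emeasure_density) auto
      also have "\<dots> \<le> 2 * (\<integral>\<^sup>+x. r x \<partial>lborel)"
        unfolding Aeq
        by (rule nn_integral_interval_cover_finite) (use I' q in \<open>auto intro!: le\<close>)
      finally show ?thesis .
    qed
    have "emeasure (density lborel w) (\<Union>(s,t)\<in>I. {s<..<t}) \<le> 2 * (\<integral>\<^sup>+x. r x \<partial>lborel)"
      unfolding Aun[symmetric] SUP_emeasure_incseq[OF rA iA, symmetric] by (rule SUP_least) (rule bd)
    moreover have "emeasure (density lborel w) (\<Union>(s,t)\<in>I. {s<..<t})
        = (\<integral>\<^sup>+x. w x * indicator (\<Union>(s,t)\<in>I. {s<..<t}) x \<partial>lborel)"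
      by (rule emeasure_density) (auto intro!: borel_open open_UN simp: case_prod_beta)
    ultimately show ?thesis by simp
  qed
qed

text \<open>
  The uncentred maximal operator of the measure with density u. The supremum runs over open intervals
  only, which makes it lower semicontinuous.
\<close>
definition weighted_maximal :: "(real \<Rightarrow> ennreal) \<Rightarrow> (real \<Rightarrow> ennreal) \<Rightarrow> real \<Rightarrow> ennreal" where
  "weighted_maximal u g x = (SUP (s,t) \<in> {(s,t). s < x \<and> x < t}.
     (\<integral>\<^sup>+y\<in>{s<..<t}. g y * u y \<partial>lborel) / (\<integral>\<^sup>+y\<in>{s<..<t}. u y \<partial>lborel))"

lemma weighted_maximal_level:
  "{x. l < weighted_maximal u g x} = (\<Union>(s,t)\<in>{(s,t). l < (\<integral>\<^sup>+y\<in>{s<..<t}. g y * u y \<partial>lborel) /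
     (\<integral>\<^sup>+y\<in>{s<..<t}. u y \<partial>lborel)}. {s<..<t})"
proof (intro set_eqI)
  fix x
  show "x \<in> {x. l < weighted_maximal u g x} \<longleftrightarrow> x \<in> (\<Union>(s,t)\<in>{(s,t). l < (\<integral>\<^sup>+y\<in>{s<..<t}. g y * u y \<partial>lborel) /
     (\<integral>\<^sup>+y\<in>{s<..<t}. u y \<partial>lborel)}. {s<..<t})"
    unfolding weighted_maximal_def mem_Collect_eq less_SUP_iff Bex_def UN_iff case_prod_beta
      greaterThanLessThan_iff by metis
qed

lemma borel_measurable_weighted_maximal [measurable]:
  "weighted_maximal u g \<in> borel_measurable borel"
proof (rule borel_measurableI_greater)
  fix l
  have "open {x. l < weighted_maximal u g x}"
    unfolding weighted_maximal_level by (auto simp: case_prod_beta)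
  then show "{x \<in> space borel. l < weighted_maximal u g x} \<in> sets borel" by simp
qed

text \<open>
  If the average of g over an interval exceeds l, then the part of g above l/2 still has an average
  of at least l/2 there. The hypothesis relating u, w and r turns this into a bound for the w-mass of
  the interval, and the covering lemma collects the intervals. Keeping only the part of g above l/2
  on the right-hand side prepares the interpolation.
\<close>
lemma weighted_maximal_weak_type:
  fixes u w r :: "real \<Rightarrow> ennreal" and g :: "real \<Rightarrow> real"
  assumes [measurable]: "u \<in> borel_measurable borel" "w \<in> borel_measurable borel"
      "r \<in> borel_measurable borel" "g \<in> borel_measurable borel"
    and fin: "\<And>s t. (\<integral>\<^sup>+y\<in>{s<..<t}. u y \<partial>lborel) < \<infinity>"
    and uwr: "\<And>s t y. s < y \<Longrightarrow> y < t \<Longrightarrow>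
      (\<integral>\<^sup>+y\<in>{s<..<t}. w y \<partial>lborel) * u y \<le> (\<integral>\<^sup>+y\<in>{s<..<t}. u y \<partial>lborel) * r y"
    and l: "0 < l"
  shows "(\<integral>\<^sup>+x\<in>{x. ennreal l < weighted_maximal u (\<lambda>y. ennreal (g y)) x}. w x \<partial>lborel)
    \<le> ennreal (4 / l) * (\<integral>\<^sup>+y\<in>{y. l / 2 < g y}. ennreal (g y) * r y \<partial>lborel)"
proof -
  define G where "G y = ennreal (g y) * indicator {y. l / 2 < g y} y" for y
  have [measurable]: "G \<in> borel_measurable borel" unfolding G_def by measurable
  have "(\<integral>\<^sup>+x\<in>{x. ennreal l < weighted_maximal u (\<lambda>y. ennreal (g y)) x}. w x \<partial>lborel)
     \<le> 2 * (\<integral>\<^sup>+y. ennreal (2 / l) * (G y * r y) \<partial>lborel)"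
    unfolding weighted_maximal_level
  proof (rule nn_integral_interval_cover)
    fix s t :: real
    define a where "a = (\<integral>\<^sup>+y\<in>{s<..<t}. u y \<partial>lborel)"
    define W where "W = (\<integral>\<^sup>+y\<in>{s<..<t}. w y \<partial>lborel)"
    define A where "A = (\<integral>\<^sup>+y\<in>{s<..<t}. ennreal (g y) * u y \<partial>lborel)"
    define B where "B = (\<integral>\<^sup>+y\<in>{s<..<t}. G y * u y \<partial>lborel)"
    define R where "R = (\<integral>\<^sup>+y\<in>{s<..<t}. G y * r y \<partial>lborel)"
    assume "(s,t) \<in> {(s,t). ennreal l < (\<integral>\<^sup>+y\<in>{s<..<t}. ennreal (g y) * u y \<partial>lborel) /
       (\<integral>\<^sup>+y\<in>{s<..<t}. u y \<partial>lborel)}"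
    then have lt: "ennreal l < A / a" by (simp add: A_def a_def)
    have afin: "a < \<infinity>" using fin by (simp add: a_def)
    \<comment> \<open>An interval without u-mass is not selected: there the quotient is 0 / 0 = 0.\<close>
    have a0: "a \<noteq> 0"
    proof
      assume a: "a = 0"
      then have "AE y in lborel. u y * indicator {s<..<t} y = 0"
        unfolding a_def by (subst (asm) nn_integral_0_iff_AE) auto
      then have "AE y in lborel. ennreal (g y) * u y * indicator {s<..<t} y = 0"
        by eventually_elim (auto simp: indicator_def split: if_splits)
      then have "A = 0"
        unfolding A_def by (subst nn_integral_0_iff_AE) auto
      then show False using lt a by simp
    qed
    have lA: "ennreal l * a < A"
      using lt a0 afin by (metis divide_le_posI_ennreal mult.commute not_le zero_less_iff_neq_zero)
    have "A \<le> (\<integral>\<^sup>+y. G y * u y * indicator {s<..<t} y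
         + ennreal (l/2) * (u y * indicator {s<..<t} y) \<partial>lborel)"
      unfolding A_def
    proof (rule nn_integral_mono)
      fix y
      have "ennreal (g y) \<le> G y + ennreal (l/2)"
        by (auto simp: G_def indicator_def intro: ennreal_leI)
      then have "ennreal (g y) * (u y * indicator {s<..<t} y) \<le> (G y + ennreal (l/2)) * (u y * indicator {s<..<t} y)"
        by (rule mult_right_mono) simp
      then show "ennreal (g y) * u y * indicator {s<..<t} y \<le> G y * u y * indicator {s<..<t} y
         + ennreal (l/2) * (u y * indicator {s<..<t} y)"
        by (simp add: algebra_simps)
    qed
    also have "\<dots> = B + ennreal (l/2) * a"
      unfolding B_def a_def by (subst nn_integral_add) (auto simp: nn_integral_cmult)
    finally have "ennreal l * a < B + ennreal (l/2) * a" using lA by order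
    moreover have "ennreal l * a = ennreal (l/2) * a + ennreal (l/2) * a"
      using l by (simp add: distrib_right[symmetric] ennreal_plus[symmetric] del: ennreal_plus)
    ultimately have "ennreal (l/2) * a + ennreal (l/2) * a < ennreal (l/2) * a + B"
      by (simp add: add.commute)
    then have half: "ennreal (l/2) * a \<le> B"
      unfolding ennreal_add_left_cancel_less by (blast intro: less_imp_le)
    have "W * B = (\<integral>\<^sup>+y. W * (G y * u y * indicator {s<..<t} y) \<partial>lborel)"
      unfolding B_def by (rule nn_integral_cmult[symmetric]) measurable
    also have "\<dots> \<le> (\<integral>\<^sup>+y. a * (G y * r y * indicator {s<..<t} y) \<partial>lborel)"
    proof (rule nn_integral_mono)
      fix y
      show "W * (G y * u y * indicator {s<..<t} y) \<le> a * (G y * r y * indicator {s<..<t} y)"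
      proof (cases "y \<in> {s<..<t}")
        case True
        then have "W * u y \<le> a * r y" using uwr[of s y t] by (simp add: W_def a_def)
        then have "G y * (W * u y) \<le> G y * (a * r y)" by (rule mult_left_mono) simp
        then show ?thesis using True by (simp add: mult_ac)
      qed simp
    qed
    also have "\<dots> = a * R"
      unfolding R_def by (rule nn_integral_cmult) measurable
    finally have WB: "W * B \<le> a * R" .
    have "a * (ennreal (l/2) * W) \<le> a * R"
    proof -
      have "a * (ennreal (l/2) * W) = W * (ennreal (l/2) * a)" by (simp add: mult_ac)
      also have "\<dots> \<le> W * B" using half by (rule mult_left_mono) simp
      finally show ?thesis using WB by simp
    qed
    then have WR: "ennreal (l/2) * W \<le> R"
      using a0 afin by (simp add: ennreal_mult_le_mult_iff)
    have "W = ennreal (2/l) * (ennreal (l/2) * W)"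
      using l by (simp add: mult.assoc[symmetric] ennreal_mult[symmetric])
    also have "\<dots> \<le> ennreal (2/l) * R" using WR by (rule mult_left_mono) simp
    also have "\<dots> = (\<integral>\<^sup>+y. ennreal (2/l) * (G y * r y * indicator {s<..<t} y) \<partial>lborel)"
      unfolding R_def by (rule nn_integral_cmult[symmetric]) measurable
    finally show "(\<integral>\<^sup>+y. w y * indicator {s<..<t} y \<partial>lborel)
       \<le> (\<integral>\<^sup>+y. ennreal (2/l) * (G y * r y) * indicator {s<..<t} y \<partial>lborel)"
      by (simp add: W_def mult.assoc)
  qed measurable
  also have "\<dots> = 2 * (ennreal (2 / l) * (\<integral>\<^sup>+y. G y * r y \<partial>lborel))"
    by (subst nn_integral_cmult) auto
  also have "\<dots> = ennreal (4 / l) * (\<integral>\<^sup>+y. G y * r y \<partial>lborel)"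
  proof -
    have "ennreal (4/l) = 2 * ennreal (2/l)"
      using l by (simp add: ennreal_mult'[symmetric] flip: ennreal_numeral)
    then show ?thesis by (simp add: mult.assoc)
  qed
  also have "(\<integral>\<^sup>+y. G y * r y \<partial>lborel) = (\<integral>\<^sup>+y\<in>{y. l / 2 < g y}. ennreal (g y) * r y \<partial>lborel)"
    by (rule nn_integral_cong) (simp add: G_def mult_ac)
  finally show ?thesis .
qed

lemma nn_integral_powr_below:
  fixes a b :: real
  assumes "-1 < a" "0 \<le> b"
  shows "(\<integral>\<^sup>+l. ennreal (l powr a) * indicator {0<..<b} l \<partial>lborel) = ennreal (b powr (a+1) / (a+1))"
proof -
  have "(\<integral>\<^sup>+l. ennreal (l powr a) * indicator {0<..<b} l \<partial>lborel)
      = (\<integral>\<^sup>+l. ennreal (l powr a) * indicator {0..b} l \<partial>lborel)"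
  proof (rule nn_integral_cong_AE)
    have "AE l in lborel. l \<noteq> 0 \<and> l \<noteq> b"
      using AE_lborel_singleton[of 0] AE_lborel_singleton[of b] by eventually_elim simp
    then show "AE l in lborel. ennreal (l powr a) * indicator {0<..<b} l = ennreal (l powr a) * indicator {0..b} l"
      by eventually_elim (auto simp: indicator_def)
  qed
  also have "\<dots> = ennreal (b powr (a+1) / (a+1))"
    by (rule nn_integral_has_integral_lebesgue') (use assms in \<open>auto intro: has_integral_powr_from_0\<close>)
  finally show ?thesis .
qed

text \<open>
  The layer cake formula, valid for the value \<open>\<infinity>\<close> as well: there the integral exceeds every power.
\<close>
lemma epowr_layer_cake:
  assumes p: "0 < p"
  shows "epowr t p = (\<integral>\<^sup>+l. ennreal (p * l powr (p - 1)) * indicator {l. 0 < l \<and> ennreal l < t} l \<partial>lborel)"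
proof -
  have *: "(\<integral>\<^sup>+l. ennreal (p * l powr (p - 1)) * indicator {l. 0 < l \<and> ennreal l < ennreal b} l \<partial>lborel)
     = ennreal (b powr p)" if b: "0 \<le> b" for b
  proof -
    have "{l. 0 < l \<and> ennreal l < ennreal b} = {0<..<b}"
      using b by (auto simp: ennreal_less_iff)
    then have "(\<integral>\<^sup>+l. ennreal (p * l powr (p - 1)) * indicator {l. 0 < l \<and> ennreal l < ennreal b} l \<partial>lborel)
      = (\<integral>\<^sup>+l. ennreal p * (ennreal (l powr (p - 1)) * indicator {0<..<b} l) \<partial>lborel)"
      using p by (simp add: ennreal_mult mult.assoc)
    also have "\<dots> = ennreal p * ennreal (b powr p / p)"
      using nn_integral_powr_below[of "p - 1" b] p b by (subst nn_integral_cmult) auto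
    also have "\<dots> = ennreal (b powr p)" using p by (simp add: ennreal_mult[symmetric])
    finally show ?thesis .
  qed
  show ?thesis
  proof (cases t)
    case (real b)
    then show ?thesis using *[of b] by (simp add: epowr_def)
  next
    case top
    let ?X = "\<integral>\<^sup>+l. ennreal (p * l powr (p - 1)) * indicator {l. 0 < l \<and> ennreal l < t} l \<partial>lborel"
    have "?X = \<infinity>"
    proof (rule ccontr)
      assume "?X \<noteq> \<infinity>"
      then obtain r where r: "0 \<le> r" "?X = ennreal r" by (cases ?X) auto
      define b where "b = (r + 1) powr (1 / p)"
      have b: "0 \<le> b" "b powr p = r + 1" using r p by (auto simp: b_def powr_powr)
      have "ennreal (b powr p) \<le> ?X"
        unfolding *[OF b(1), symmetric]
        by (rule nn_integral_mono) (auto simp: indicator_def top)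
      then show False using r b by simp
    qed
    then show ?thesis by (simp add: top epowr_def)
  qed
qed

text \<open>
  The argument of Marcinkiewicz: the weak type bound is integrated against the layers of T, and after
  exchanging the integrals the inner one runs over 0 < l < 2 g(y) only. It converges because of
  p > 1.
\<close>
lemma strong_type_of_weak_type:
  fixes T w r :: "real \<Rightarrow> ennreal" and g :: "real \<Rightarrow> real"
  assumes p: "1 < p" and g0: "\<And>x. 0 \<le> g x"
    and [measurable]: "T \<in> borel_measurable borel" "w \<in> borel_measurable borel"
      "r \<in> borel_measurable borel" "g \<in> borel_measurable borel"
    and weak: "\<And>l. 0 < l \<Longrightarrow> (\<integral>\<^sup>+x\<in>{x. ennreal l < T x}. w x \<partial>lborel)
      \<le> ennreal (4 / l) * (\<integral>\<^sup>+y\<in>{y. l / 2 < g y}. ennreal (g y) * r y \<partial>lborel)"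
  shows "(\<integral>\<^sup>+x. epowr (T x) p * w x \<partial>lborel)
    \<le> ennreal (4 * p * 2 powr (p - 1) / (p - 1)) * (\<integral>\<^sup>+x. ennreal (g x powr p) * r x \<partial>lborel)"
proof -
  have meas_lt: "{(x, l). 0 < l \<and> ennreal l < T x} \<in> sets (borel \<Otimes>\<^sub>M borel)"
  proof -
    have "{q \<in> space (borel \<Otimes>\<^sub>M borel). 0 < snd q \<and> ennreal (snd q) < T (fst q)} \<in> sets (borel \<Otimes>\<^sub>M borel)"
      by measurable
    moreover have "{q \<in> space (borel \<Otimes>\<^sub>M borel). 0 < snd q \<and> ennreal (snd q) < T (fst q)} = {(x, l). 0 < l \<and> ennreal l < T x}"
      by (auto simp: space_pair_measure)
    ultimately show ?thesis by simp
  qed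
  have [measurable]: "(\<lambda>(x,l). indicator {l. 0 < l \<and> ennreal l < T x} l :: ennreal) \<in> borel_measurable (borel \<Otimes>\<^sub>M borel)"
  proof -
    have "(\<lambda>(x,l). indicator {l. 0 < l \<and> ennreal l < T x} l :: ennreal) = indicator {(x, l). 0 < l \<and> ennreal l < T x}"
      by (auto simp: fun_eq_iff indicator_def)
    then show ?thesis using meas_lt by simp
  qed
  have [measurable]: "(\<lambda>x. indicator {l. 0 < l \<and> ennreal l < t} x :: ennreal) \<in> borel_measurable borel" for t
    by measurable
  have "(\<integral>\<^sup>+x. epowr (T x) p * w x \<partial>lborel)
    = (\<integral>\<^sup>+x. (\<integral>\<^sup>+l. ennreal (p * l powr (p - 1)) * indicator {l. 0 < l \<and> ennreal l < T x} l * w x \<partial>lborel) \<partial>lborel)"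
  proof (rule nn_integral_cong)
    fix x
    show "epowr (T x) p * w x = (\<integral>\<^sup>+l. ennreal (p * l powr (p - 1)) * indicator {l. 0 < l \<and> ennreal l < T x} l * w x \<partial>lborel)"
      using p by (subst epowr_layer_cake) (auto intro!: nn_integral_multc[symmetric])
  qed
  also have "\<dots> = (\<integral>\<^sup>+l. (\<integral>\<^sup>+x. ennreal (p * l powr (p - 1)) * indicator {l. 0 < l \<and> ennreal l < T x} l * w x \<partial>lborel) \<partial>lborel)"
    by (rule lborel_pair.Fubini') (simp add: case_prod_beta)
  also have "\<dots> \<le> (\<integral>\<^sup>+l. (\<integral>\<^sup>+y. ennreal (4 * p * l powr (p - 2)) * indicator {0<..<2 * g y} l * (ennreal (g y) * r y) \<partial>lborel) \<partial>lborel)"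
  proof (rule nn_integral_mono)
    fix l :: real
    show "(\<integral>\<^sup>+x. ennreal (p * l powr (p - 1)) * indicator {l. 0 < l \<and> ennreal l < T x} l * w x \<partial>lborel)
       \<le> (\<integral>\<^sup>+y. ennreal (4 * p * l powr (p - 2)) * indicator {0<..<2 * g y} l * (ennreal (g y) * r y) \<partial>lborel)"
    proof (cases "0 < l")
      case True
      have "(\<integral>\<^sup>+x. ennreal (p * l powr (p - 1)) * indicator {l. 0 < l \<and> ennreal l < T x} l * w x \<partial>lborel)
        = (\<integral>\<^sup>+x. ennreal (p * l powr (p - 1)) * (w x * indicator {x. ennreal l < T x} x) \<partial>lborel)"
        using True by (intro nn_integral_cong) (auto simp: indicator_def)
      also have "\<dots> = ennreal (p * l powr (p - 1)) * (\<integral>\<^sup>+x\<in>{x. ennreal l < T x}. w x \<partial>lborel)"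
        by (rule nn_integral_cmult) measurable
      also have "\<dots> \<le> ennreal (p * l powr (p - 1)) * (ennreal (4 / l) * (\<integral>\<^sup>+y\<in>{y. l / 2 < g y}. ennreal (g y) * r y \<partial>lborel))"
        by (rule mult_left_mono[OF weak[OF True]]) simp
      also have "\<dots> = ennreal (4 * p * l powr (p - 2)) * (\<integral>\<^sup>+y\<in>{y. l / 2 < g y}. ennreal (g y) * r y \<partial>lborel)"
      proof -
        have "p * l powr (p - 1) * (4 / l) = 4 * p * l powr (p - 2)"
          using True powr_diff[of l "p - 1" 1] by (simp add: field_simps)
        then show ?thesis using p True by (simp add: mult.assoc[symmetric] ennreal_mult[symmetric])
      qed
      also have "\<dots> = (\<integral>\<^sup>+y. ennreal (4 * p * l powr (p - 2)) * (ennreal (g y) * r y * indicator {y. l / 2 < g y} y) \<partial>lborel)"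
        by (rule nn_integral_cmult[symmetric]) measurable
      also have "\<dots> = (\<integral>\<^sup>+y. ennreal (4 * p * l powr (p - 2)) * indicator {0<..<2 * g y} l * (ennreal (g y) * r y) \<partial>lborel)"
        using True by (intro nn_integral_cong) (auto simp: indicator_def)
      finally show ?thesis .
    qed (simp add: indicator_def)
  qed
  also have "\<dots> = (\<integral>\<^sup>+y. (\<integral>\<^sup>+l. ennreal (4 * p * l powr (p - 2)) * indicator {0<..<2 * g y} l * (ennreal (g y) * r y) \<partial>lborel) \<partial>lborel)"
  proof (rule lborel_pair.Fubini')
    have "{q \<in> space (borel \<Otimes>\<^sub>M borel). 0 < snd q \<and> snd q < 2 * g (fst q)} \<in> sets (borel \<Otimes>\<^sub>M borel)"
      by measurable
    moreover have "{q \<in> space (borel \<Otimes>\<^sub>M borel). 0 < snd q \<and> snd q < 2 * g (fst q)} = {(y, l). 0 < l \<and> l < 2 * g y}"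
      by (auto simp: space_pair_measure)
    ultimately have *: "{(y, l). 0 < l \<and> l < 2 * g y} \<in> sets (borel \<Otimes>\<^sub>M borel)" by simp
    have "(\<lambda>(y,l). indicator {0<..<2 * g y} l :: ennreal) = indicator {(y, l). 0 < l \<and> l < 2 * g y}"
      by (auto simp: fun_eq_iff indicator_def)
    then have [measurable]: "(\<lambda>(y,l). indicator {0<..<2 * g y} l :: ennreal) \<in> borel_measurable (borel \<Otimes>\<^sub>M borel)"
      using * by simp
    show "(\<lambda>(y,l). ennreal (4 * p * l powr (p - 2)) * indicator {0<..<2 * g y} l * (ennreal (g y) * r y))
       \<in> borel_measurable (lborel \<Otimes>\<^sub>M lborel)"
      by (simp add: case_prod_beta)
  qed
  also have "\<dots> = (\<integral>\<^sup>+y. ennreal (4 * p * 2 powr (p - 1) / (p - 1)) * (ennreal (g y powr p) * r y) \<partial>lborel)"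
  proof (rule nn_integral_cong)
    fix y
    have "(\<integral>\<^sup>+l. ennreal (4 * p * l powr (p - 2)) * indicator {0<..<2 * g y} l * (ennreal (g y) * r y) \<partial>lborel)
      = (\<integral>\<^sup>+l. ennreal (4 * p * l powr (p - 2)) * indicator {0<..<2 * g y} l \<partial>lborel) * (ennreal (g y) * r y)"
      by (rule nn_integral_multc) measurable
    also have "(\<integral>\<^sup>+l. ennreal (4 * p * l powr (p - 2)) * indicator {0<..<2 * g y} l \<partial>lborel)
      = (\<integral>\<^sup>+l. ennreal (4 * p) * (ennreal (l powr (p - 2)) * indicator {0<..<2 * g y} l) \<partial>lborel)"
      using p by (simp add: ennreal_mult mult.assoc)
    also have "\<dots> = ennreal (4 * p) * ennreal ((2 * g y) powr (p - 1) / (p - 1))"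
      using nn_integral_powr_below[of "p - 2" "2 * g y"] p g0[of y] by (subst nn_integral_cmult) auto
    also have "ennreal (4 * p) * ennreal ((2 * g y) powr (p - 1) / (p - 1)) * (ennreal (g y) * r y)
      = ennreal (4 * p * ((2 * g y) powr (p - 1) / (p - 1)) * g y) * r y"
    proof -
      have "ennreal (4 * p * ((2 * g y) powr (p - 1) / (p - 1)) * g y)
         = ennreal (4 * p) * ennreal ((2 * g y) powr (p - 1) / (p - 1)) * ennreal (g y)"
        using p g0[of y] by (subst ennreal_mult[symmetric], simp, simp, subst ennreal_mult[symmetric]) auto
      then show ?thesis by (simp only: mult.assoc)
    qed
    also have "4 * p * ((2 * g y) powr (p - 1) / (p - 1)) * g y = 4 * p * 2 powr (p - 1) / (p - 1) * g y powr p"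
    proof (cases "g y = 0")
      case False
      then have "g y > 0" using g0[of y] by simp
      then have "g y powr (p - 1) * g y = g y powr p" by (simp add: powr_diff)
      then show ?thesis using \<open>g y > 0\<close> by (simp add: powr_mult algebra_simps)
    qed simp
    finally show "(\<integral>\<^sup>+l. ennreal (4 * p * l powr (p - 2)) * indicator {0<..<2 * g y} l * (ennreal (g y) * r y) \<partial>lborel)
       = ennreal (4 * p * 2 powr (p - 1) / (p - 1)) * (ennreal (g y powr p) * r y)"
      using ennreal_mult[of "4 * p * 2 powr (p - 1) / (p - 1)" "g y powr p"] p by (simp add: mult.assoc)
  qed
  also have "\<dots> = ennreal (4 * p * 2 powr (p - 1) / (p - 1)) * (\<integral>\<^sup>+x. ennreal (g x powr p) * r x \<partial>lborel)"
    by (rule nn_integral_cmult) measurable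
  finally show ?thesis .
qed

lemma epowr_mono: "a \<le> b \<Longrightarrow> 0 < r \<Longrightarrow> epowr a r \<le> epowr b r"
  by (cases a; cases b) (auto simp: epowr_def top_unique intro!: ennreal_leI powr_mono2)

lemma epowr_ennreal: "0 \<le> a \<Longrightarrow> epowr (ennreal a) r = ennreal (a powr r)"
  by (simp add: epowr_def)

lemma epowr_mult:
  assumes "0 < r"
  shows "epowr (a * b) r = epowr a r * epowr b r"
proof (cases a)
  case (real x)
  show ?thesis
  proof (cases b)
    case (real y)
    then show ?thesis using \<open>0 \<le> x\<close> \<open>a = ennreal x\<close>
      by (simp add: ennreal_mult[symmetric] epowr_ennreal powr_mult)
  next
    case top
    then show ?thesis using real assms by (auto simp: epowr_def ennreal_mult_top ennreal_top_mult)
  qed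
next
  case top
  show ?thesis
  proof (cases b)
    case (real y)
    then show ?thesis using top assms by (auto simp: epowr_def ennreal_mult_top ennreal_top_mult)
  qed (use top in \<open>auto simp: epowr_def\<close>)
qed

lemma borel_measurable_epowr [measurable]:
  assumes [measurable]: "f \<in> borel_measurable M"
  shows "(\<lambda>x. epowr (f x) r) \<in> borel_measurable M"
  unfolding epowr_def by measurable

text \<open>
  Used with u = 1 and r = Mw, where the hypothesis on u, w, r says that Mw dominates the averages of
  w, and with u = w = r, where it is an equality.
\<close>
lemma weighted_maximal_strong_type:
  fixes u w r :: "real \<Rightarrow> ennreal" and g :: "real \<Rightarrow> real"
  assumes p: "1 < p" and g0: "\<And>x. 0 \<le> g x"
    and m[measurable]: "u \<in> borel_measurable borel" "w \<in> borel_measurable borel"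
      "r \<in> borel_measurable borel" "g \<in> borel_measurable borel"
    and fin: "\<And>s t. (\<integral>\<^sup>+y\<in>{s<..<t}. u y \<partial>lborel) < \<infinity>"
    and uwr: "\<And>s t y. s < y \<Longrightarrow> y < t \<Longrightarrow>
      (\<integral>\<^sup>+y\<in>{s<..<t}. w y \<partial>lborel) * u y \<le> (\<integral>\<^sup>+y\<in>{s<..<t}. u y \<partial>lborel) * r y"
  shows "(\<integral>\<^sup>+x. epowr (weighted_maximal u (\<lambda>y. ennreal (g y)) x) p * w x \<partial>lborel)
    \<le> ennreal (4 * p * 2 powr (p - 1) / (p - 1)) * (\<integral>\<^sup>+x. ennreal (g x powr p) * r x \<partial>lborel)"
  by (rule strong_type_of_weak_type[OF p g0])
     (use m weighted_maximal_weak_type[OF m fin uwr] in auto)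

lemma emeasure_interval_nn_integral: "(\<integral>\<^sup>+y\<in>{s<..<t::real}. 1 \<partial>lborel) = ennreal (t - s)"
proof (cases "s \<le> t")
  case False
  then show ?thesis by (simp add: ennreal_neg)
qed simp

text \<open>
  A bounded interval of positive length is contained in slightly longer open ones, over which the
  averages are not much smaller. Hence open intervals produce the same supremum at every point.
\<close>
lemma maximal_eq_weighted_maximal:
  "maximal f x = weighted_maximal (\<lambda>_. 1) (\<lambda>y. ennreal \<bar>f y\<bar>) x"
proof (rule antisym)
  show "maximal f x \<le> weighted_maximal (\<lambda>_. 1) (\<lambda>y. ennreal \<bar>f y\<bar>) x" (is "_ \<le> ?S")
    unfolding maximal_def
  proof (rule SUP_least)
    fix Q :: "real set"
    assume "Q \<in> {Q. is_interval Q \<and> bounded Q \<and> 0 < emeasure lebesgue Q}"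
    then have Q: "is_interval Q" "bounded Q" "0 < emeasure lebesgue Q" by auto
    define I where "I = (\<integral>\<^sup>+y\<in>Q. ennreal \<bar>f y\<bar> \<partial>lborel)"
    show "indicator Q x / emeasure lebesgue Q * (\<integral>\<^sup>+y\<in>Q. ennreal \<bar>f y\<bar> \<partial>lebesgue) \<le> ?S"
    proof (cases "x \<in> Q")
      case True
      define a where "a = Inf Q"
      define b where "b = Sup Q"
      have bdd: "bdd_below Q" "bdd_above Q" and ne: "Q \<noteq> {}"
        using Q True by (auto simp: bounded_imp_bdd_above bounded_imp_bdd_below)
      have sub: "Q \<subseteq> {a..b}" unfolding a_def b_def using bdd by (auto intro: cInf_lower cSup_upper)
      have sup: "{a<..<b} \<subseteq> Q"
      proof
        fix y assume "y \<in> {a<..<b}"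
        then obtain q1 q2 where "q1 \<in> Q" "q1 < y" "q2 \<in> Q" "y < q2"
          unfolding a_def b_def using ne bdd by (auto simp: cInf_less_iff less_cSup_iff)
        then show "y \<in> Q" using mem_is_interval_1_I[OF Q(1), of q1 q2 y] by auto
      qed
      have Qm: "Q \<in> sets lebesgue" using Q(3) emeasure_notin_sets by (metis less_irrefl)
      have le1: "emeasure lebesgue Q \<le> ennreal (b - a)"
      proof -
        have "emeasure lebesgue Q \<le> emeasure lebesgue {a..b}" using sub by (intro emeasure_mono) auto
        moreover have "a \<le> b" using sub True by auto
        ultimately show ?thesis by simp
      qed
      then have "0 < ennreal (b - a)" using Q(3) by order
      then have ab: "a < b" by simp
      have le2: "ennreal (b - a) \<le> emeasure lebesgue Q"
        using emeasure_mono[OF sup Qm] ab by simp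
      have eq: "emeasure lebesgue Q = ennreal (b - a)" using le1 le2 by (rule antisym)
      have avg: "I \<le> ?S * ennreal (b - a + 2 * e)" if e: "0 < e" for e
      proof -
        have "(\<integral>\<^sup>+y\<in>{a-e<..<b+e}. ennreal \<bar>f y\<bar> * 1 \<partial>lborel) / (\<integral>\<^sup>+y\<in>{a-e<..<b+e}. 1 \<partial>lborel) \<le> ?S"
          unfolding weighted_maximal_def
          using sub True e by (intro SUP_upper2[of "(a-e,b+e)"]) auto
        moreover have "I \<le> (\<integral>\<^sup>+y\<in>{a-e<..<b+e}. ennreal \<bar>f y\<bar> * 1 \<partial>lborel)"
          unfolding I_def using sub e by (intro nn_integral_mono) (auto simp: indicator_def)
        ultimately have "I / ennreal (b - a + 2 * e) \<le> ?S"
          unfolding emeasure_interval_nn_integral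
          using divide_right_mono_ennreal by (smt (verit) order_trans)
        then have "I / ennreal (b - a + 2 * e) * ennreal (b - a + 2 * e) \<le> ?S * ennreal (b - a + 2 * e)"
          by (rule mult_right_mono) simp
        moreover have "I / ennreal (b - a + 2 * e) * ennreal (b - a + 2 * e) = I"
          using ab e by (subst ennreal_divide_times) (simp add: ennreal_mult_divide_eq)
        ultimately show ?thesis by simp
      qed
      have "I \<le> ?S * ennreal (b - a)"
      proof (cases ?S)
        case (real s)
        have "I \<noteq> \<infinity>" using avg[of 1] real by (auto simp: top_unique ennreal_mult_eq_top_iff)
        then obtain i where i: "0 \<le> i" "I = ennreal i" by (cases I) auto
        have "i \<le> s * (b - a + 2 * e)" if "0 < e" for e
          using avg[OF that] real i ab that by (simp add: ennreal_mult[symmetric] del: ennreal_plus)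
        then have *: "i \<le> s * (b - a) + e * (2 * s)" if "0 < e" for e
          using that by (simp add: algebra_simps)
        have "i \<le> s * (b - a)"
        proof (rule field_le_epsilon)
          fix e :: real assume e: "0 < e"
          \<comment> \<open>The denominator 2 s + 1 is used because s may be 0.\<close>
          have "e / (2 * s + 1) * (2 * s) \<le> e" using e real by (simp add: field_simps)
          then show "i \<le> s * (b - a) + e" using *[of "e / (2 * s + 1)"] e real by (smt (verit) divide_pos_pos)
        qed
        then show ?thesis using real i ab by (simp add: ennreal_mult[symmetric])
      next
        case top
        then show ?thesis using ab by (simp add: ennreal_top_mult)
      qed
      then have "I / ennreal (b - a) \<le> ?S"
        using ab by (intro divide_le_posI_ennreal) (auto simp: mult.commute)
      then show ?thesis using True by (simp add: eq I_def nn_integral_completion ennreal_times_divide divide_ennreal_def mult.commute)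
    qed simp
  qed
  show "?S \<le> maximal f x"
    unfolding weighted_maximal_def
  proof (rule SUP_least, clarify)
    fix s t assume st: "s < x" "x < t"
    have "indicator {s<..<t} x / emeasure lebesgue {s<..<t} * (\<integral>\<^sup>+y\<in>{s<..<t}. ennreal \<bar>f y\<bar> \<partial>lebesgue) \<le> maximal f x"
      unfolding maximal_def using st by (intro SUP_upper) auto
    then show "(\<integral>\<^sup>+y\<in>{s<..<t}. ennreal \<bar>f y\<bar> * 1 \<partial>lborel) / (\<integral>\<^sup>+y\<in>{s<..<t}. 1 \<partial>lborel) \<le> maximal f x"
      using st unfolding emeasure_interval_nn_integral
      by (simp add: nn_integral_completion divide_ennreal_def mult.commute)
  qed
qed

lemma borel_measurable_maximal [measurable]: "maximal f \<in> borel_measurable borel"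
  unfolding maximal_eq_weighted_maximal[abs_def] by measurable

lemma average_le_maximal:
  assumes "s < x" "x < t"
  shows "(\<integral>\<^sup>+y\<in>{s<..<t}. ennreal \<bar>f y\<bar> \<partial>lborel) \<le> ennreal (t - s) * maximal f x"
proof -
  have "(\<integral>\<^sup>+y\<in>{s<..<t}. ennreal \<bar>f y\<bar> * 1 \<partial>lborel) / (\<integral>\<^sup>+y\<in>{s<..<t}. 1 \<partial>lborel) \<le> maximal f x"
    unfolding maximal_eq_weighted_maximal weighted_maximal_def
    using assms by (intro SUP_upper2[of "(s,t)"]) auto
  then have "(\<integral>\<^sup>+y\<in>{s<..<t}. ennreal \<bar>f y\<bar> \<partial>lborel) / ennreal (t - s) * ennreal (t - s) \<le> maximal f x * ennreal (t - s)"
    unfolding emeasure_interval_nn_integral by (intro mult_right_mono) auto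
  moreover have "(\<integral>\<^sup>+y\<in>{s<..<t}. ennreal \<bar>f y\<bar> \<partial>lborel) / ennreal (t - s) * ennreal (t - s)
      = (\<integral>\<^sup>+y\<in>{s<..<t}. ennreal \<bar>f y\<bar> \<partial>lborel)"
    using assms by (subst ennreal_divide_times) (simp add: ennreal_mult_divide_eq)
  ultimately show ?thesis by (simp add: mult.commute)
qed

lemma maximal_le:
  assumes "\<And>s t. s < x \<Longrightarrow> x < t \<Longrightarrow> (\<integral>\<^sup>+y\<in>{s<..<t}. ennreal \<bar>f y\<bar> \<partial>lborel) \<le> ennreal (t - s) * C"
  shows "maximal f x \<le> C"
  unfolding maximal_eq_weighted_maximal weighted_maximal_def
proof (rule SUP_least, clarify)
  fix s t assume st: "s < x" "x < t"
  show "(\<integral>\<^sup>+y\<in>{s<..<t}. ennreal \<bar>f y\<bar> * 1 \<partial>lborel) / (\<integral>\<^sup>+y\<in>{s<..<t}. 1 \<partial>lborel) \<le> C"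
    unfolding emeasure_interval_nn_integral using assms[OF st] st
    by (intro divide_le_posI_ennreal) auto
qed

lemma integral_bound_imp_Lnorm_bound:
  assumes q: "0 < q"
    and le: "(\<integral>\<^sup>+x. epowr (T x) q * u2 x \<partial>lborel) \<le> C * (\<integral>\<^sup>+x. epowr (g x) q * u1 x \<partial>lborel)"
  shows "Lnorm q u2 T \<le> epowr C (1/q) * Lnorm q u1 g"
  unfolding Lnorm_def nn_integral_completion epowr_mult[OF divide_pos_pos[OF zero_less_one q], symmetric]
  using q by (intro epowr_mono le) auto

text \<open>
  The inequality of Fefferman and Stein, combined with the assumption that v dominates Mw where v is
  positive; off that set the admissible functions vanish.
\<close>
lemma maximal_bounded_Fefferman_Stein:
  fixes w :: "real \<Rightarrow> real" and v :: "real \<Rightarrow> ennreal"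
  assumes p: "1 < p" and [measurable]: "w \<in> borel_measurable borel"
    and w0: "\<And>x. 0 \<le> w x"
    and v: "\<And>x. 0 < v x \<Longrightarrow> maximal w x \<le> v x"
  shows "bounded_operator maximal p v (\<lambda>x. ennreal (w x))"
proof -
  define C where "C = ennreal (4 * p * 2 powr (p - 1) / (p - 1))"
  have "Lnorm p (\<lambda>x. ennreal (w x)) (maximal f) \<le> epowr C (1/p) * Lnorm p v (\<lambda>x. ennreal \<bar>f x\<bar>)"
    if f: "f \<in> Ldom p v" for f
  proof (rule integral_bound_imp_Lnorm_bound)
    have "f \<in> borel_measurable lebesgue" and fv: "AE x in lborel. \<not> 0 < v x \<longrightarrow> f x = 0"
      using f by (auto simp: Ldom_def AE_completion_iff)
    then obtain f' where [measurable]: "f' \<in> borel_measurable borel" and ff': "AE x in lborel. f x = f' x"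
      using completion_ex_borel_measurable_real[of f lborel] by auto
    define g where "g x = \<bar>f' x\<bar>" for x
    have [measurable]: "g \<in> borel_measurable borel" unfolding g_def by measurable
    have fg: "AE x in lborel. \<bar>f x\<bar> = g x" using ff' by eventually_elim (simp add: g_def)
    have Mf: "maximal f x = weighted_maximal (\<lambda>_. 1) (\<lambda>y. ennreal (g y)) x" for x
      unfolding maximal_eq_weighted_maximal weighted_maximal_def
      by (intro SUP_cong refl, clarify, intro arg_cong2[of _ _ _ _ "(/)"] refl nn_integral_cong_AE)
         (use fg in eventually_elim, auto)
    have "(\<integral>\<^sup>+x. epowr (maximal f x) p * ennreal (w x) \<partial>lborel)
      \<le> C * (\<integral>\<^sup>+x. ennreal (g x powr p) * maximal w x \<partial>lborel)"
      unfolding Mf C_def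
    proof (rule weighted_maximal_strong_type[OF p])
      fix s t y :: real assume "s < y" "y < t"
      then show "(\<integral>\<^sup>+y\<in>{s<..<t}. ennreal (w y) \<partial>lborel) * 1 \<le> (\<integral>\<^sup>+y\<in>{s<..<t}. 1 \<partial>lborel) * maximal w y"
        using average_le_maximal[of s y t w] w0 by (simp only: emeasure_interval_nn_integral) simp
    next
      show "(\<integral>\<^sup>+y\<in>{s<..<t}. 1 \<partial>lborel) < \<infinity>" for s t :: real
        unfolding emeasure_interval_nn_integral by simp
    qed (auto simp: g_def)
    also have "\<dots> \<le> C * (\<integral>\<^sup>+x. epowr (ennreal \<bar>f x\<bar>) p * v x \<partial>lborel)"
    proof (intro mult_left_mono nn_integral_mono_AE)
      show "AE x in lborel. ennreal (g x powr p) * maximal w x \<le> epowr (ennreal \<bar>f x\<bar>) p * v x"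
        using fg fv
      proof eventually_elim
        case (elim x)
        show ?case
        proof (cases "0 < v x")
          case True
          then show ?thesis using v[OF True] elim by (simp add: epowr_ennreal mult_left_mono)
        next
          case False
          then have "g x = 0" using elim by auto
          then show ?thesis using p by simp
        qed
      qed
    qed simp
    finally show "(\<integral>\<^sup>+x. epowr (maximal f x) p * ennreal (w x) \<partial>lborel)
      \<le> C * (\<integral>\<^sup>+x. epowr (ennreal \<bar>f x\<bar>) p * v x \<partial>lborel)" .
  qed (use p in simp)
  moreover have "epowr C (1/p) < \<infinity>" by (simp add: C_def epowr_def)
  ultimately show ?thesis unfolding bounded_operator_def by blast
qed

text \<open>
  Write f = g w. An average of f over Q is the average of w over Q times the average of g over Q with
  respect to w dx. So Mf is at most Mw times the maximal function of g for the measure w dx, and the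
  powers of Mw cancel against the target weight.
\<close>
lemma maximal_bounded_dual:
  fixes w :: "real \<Rightarrow> real"
  assumes q: "1 < q" and [measurable]: "w \<in> borel_measurable borel"
    and w0: "\<And>x. 0 \<le> w x"
    and loc: "\<And>s t. (\<integral>\<^sup>+y\<in>{s<..<t}. ennreal (w y) \<partial>lborel) < \<infinity>"
    and Mw: "\<And>x. 0 < w x \<Longrightarrow> 0 < maximal w x \<and> maximal w x < \<infinity>"
  shows "bounded_operator maximal q
      (\<lambda>x. if 0 < w x then ennreal (w x powr (1 - q)) else 0)
      (\<lambda>x. if 0 < w x then ennreal (w x) / epowr (maximal w x) q else 0)"
    (is "bounded_operator _ _ ?u1 ?u2")
proof -
  define C where "C = ennreal (4 * q * 2 powr (q - 1) / (q - 1))"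
  have "Lnorm q ?u2 (maximal f) \<le> epowr C (1/q) * Lnorm q ?u1 (\<lambda>x. ennreal \<bar>f x\<bar>)"
    if f: "f \<in> Ldom q ?u1" for f
  proof (rule integral_bound_imp_Lnorm_bound)
    have "f \<in> borel_measurable lebesgue" and "AE x in lborel. \<not> 0 < ?u1 x \<longrightarrow> f x = 0"
      using f by (auto simp: Ldom_def AE_completion_iff)
    then have fw: "AE x in lborel. w x = 0 \<longrightarrow> f x = 0"
      by (auto elim: eventually_mono)
    obtain f' where [measurable]: "f' \<in> borel_measurable borel" and ff': "AE x in lborel. f x = f' x"
      using completion_ex_borel_measurable_real[of f lborel] \<open>f \<in> borel_measurable lebesgue\<close> by auto
    define g where "g x = \<bar>f' x\<bar> / w x" for x
    have [measurable]: "g \<in> borel_measurable borel" unfolding g_def by measurable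
    have g0: "0 \<le> g x" for x using w0 by (simp add: g_def)
    have fg: "AE x in lborel. ennreal \<bar>f x\<bar> = ennreal (g x) * ennreal (w x)"
      using ff' fw
    proof eventually_elim
      case (elim x)
      then show ?case using w0[of x] g0[of x]
        by (cases "w x = 0") (auto simp: g_def ennreal_mult[symmetric])
    qed
    define T where "T = weighted_maximal (\<lambda>y. ennreal (w y)) (\<lambda>y. ennreal (g y))"
    have Mf: "maximal f x \<le> maximal w x * T x" if "0 < w x" for x
    proof (rule maximal_le)
      fix s t :: real assume st: "s < x" "x < t"
      define W where "W = (\<integral>\<^sup>+y\<in>{s<..<t}. ennreal (w y) \<partial>lborel)"
      define A where "A = (\<integral>\<^sup>+y\<in>{s<..<t}. ennreal (g y) * ennreal (w y) \<partial>lborel)"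
      have "(\<integral>\<^sup>+y\<in>{s<..<t}. ennreal \<bar>f y\<bar> \<partial>lborel) = A"
        unfolding A_def by (rule nn_integral_cong_AE) (use fg in \<open>eventually_elim, auto\<close>)
      also have "A \<le> W * (A / W)"
      proof (cases "W = 0")
        case True
        then have "AE y in lborel. ennreal (w y) * indicator {s<..<t} y = 0"
          unfolding W_def by (subst (asm) nn_integral_0_iff_AE) auto
        then have "AE y in lborel. ennreal (g y) * ennreal (w y) * indicator {s<..<t} y = 0"
          by eventually_elim (auto simp: indicator_def split: if_splits)
        then have "A = 0" unfolding A_def by (subst nn_integral_0_iff_AE) auto
        then show ?thesis by simp
      next
        case False
        have "W < \<infinity>" using loc by (simp add: W_def)
        then have "A / W * W = A" using False by (subst ennreal_divide_times) (simp add: ennreal_mult_divide_eq less_top)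
        then show ?thesis by (simp add: mult.commute)
      qed
      also have "\<dots> \<le> (ennreal (t - s) * maximal w x) * T x"
      proof (rule mult_mono)
        show "W \<le> ennreal (t - s) * maximal w x"
          using average_le_maximal[OF st, of w] w0 by (simp add: W_def)
        show "A / W \<le> T x"
          unfolding T_def weighted_maximal_def A_def W_def
          using st by (intro SUP_upper2[of "(s,t)"]) auto
      qed auto
      finally show "(\<integral>\<^sup>+y\<in>{s<..<t}. ennreal \<bar>f y\<bar> \<partial>lborel) \<le> ennreal (t - s) * (maximal w x * T x)"
        by (simp add: mult.assoc)
    qed
    have "(\<integral>\<^sup>+x. epowr (maximal f x) q * ?u2 x \<partial>lborel) \<le> (\<integral>\<^sup>+x. epowr (T x) q * ennreal (w x) \<partial>lborel)"
    proof (rule nn_integral_mono)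
      fix x
      show "epowr (maximal f x) q * ?u2 x \<le> epowr (T x) q * ennreal (w x)"
      proof (cases "0 < w x")
        case True
        define m where "m = epowr (maximal w x) q"
        obtain a where a: "maximal w x = ennreal a" "0 < a"
          using Mw[OF True] by (cases "maximal w x") auto
        have m: "m \<noteq> 0" "m \<noteq> top" using a by (auto simp: m_def epowr_ennreal)
        have "epowr (maximal f x) q \<le> m * epowr (T x) q"
          unfolding m_def using q by (subst epowr_mult[symmetric]) (auto intro!: epowr_mono Mf True)
        then have "epowr (maximal f x) q * (ennreal (w x) / m) \<le> m * epowr (T x) q * (ennreal (w x) / m)"
          by (rule mult_right_mono) simp
        also have "\<dots> = epowr (T x) q * (ennreal (w x) / m * m)" by (simp add: mult_ac)
        also have "ennreal (w x) / m * m = ennreal (w x)"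
          using m by (subst ennreal_divide_times) (simp add: ennreal_divide_self less_top)
        finally show ?thesis using True by (simp add: m_def)
      qed simp
    qed
    also have "\<dots> \<le> C * (\<integral>\<^sup>+x. ennreal (g x powr q) * ennreal (w x) \<partial>lborel)"
      unfolding T_def C_def
      by (rule weighted_maximal_strong_type[OF q]) (use loc g0 in auto)
    also have "(\<integral>\<^sup>+x. ennreal (g x powr q) * ennreal (w x) \<partial>lborel) = (\<integral>\<^sup>+x. epowr (ennreal \<bar>f x\<bar>) q * ?u1 x \<partial>lborel)"
    proof (rule nn_integral_cong_AE)
      show "AE x in lborel. ennreal (g x powr q) * ennreal (w x) = epowr (ennreal \<bar>f x\<bar>) q * ?u1 x"
        using ff'
      proof eventually_elim
        case (elim x)
        show ?case
        proof (cases "0 < w x")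
          case True
          have "g x powr q * w x = \<bar>f x\<bar> powr q * w x powr (1 - q)"
            using True elim by (simp add: g_def powr_divide powr_diff)
          then show ?thesis using True by (simp add: epowr_ennreal ennreal_mult[symmetric])
        next
          case False
          then show ?thesis using w0[of x] by simp
        qed
      qed
    qed
    finally show "(\<integral>\<^sup>+x. epowr (maximal f x) q * ?u2 x \<partial>lborel)
      \<le> C * (\<integral>\<^sup>+x. epowr (ennreal \<bar>f x\<bar>) q * ?u1 x \<partial>lborel)" .
  qed (use q in simp)
  moreover have "epowr C (1/q) < \<infinity>" by (simp add: C_def epowr_def)
  ultimately show ?thesis unfolding bounded_operator_def by blast
qed

section \<open>The pattern for a fixed branching number\<close>
definition side :: "nat \<Rightarrow> nat \<Rightarrow> int" where
  "side L k = (2 * int L) ^ k"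

text \<open>
  The density on the unit cell [c, c+1) of the pattern that occupies [0, (2L)^k). Cell 1 stays empty
  so that a plateau does not touch the denser copies to its right; the empty right half does the same
  for the plateau of the next interval and makes the pattern asymmetric.
\<close>
fun cell_weight :: "nat \<Rightarrow> nat \<Rightarrow> int \<Rightarrow> real" where
  "cell_weight L 0 c = (if c = 0 then 1 else 0)"
| "cell_weight L (Suc k) c =
    (if c div side L k = 0 then (1/2) ^ Suc k
     else if c div side L k \<in> {2..int L + 1} then cell_weight L k (c mod side L k)
     else 0)"

lemma side_0 [simp]: "side L 0 = 1" by (simp add: side_def)
lemma side_Suc: "side L (Suc k) = 2 * int L * side L k" by (simp add: side_def)

lemma cell_weight_nonneg: "0 \<le> cell_weight L k c"
  by (induction k arbitrary: c) auto

lemma half_power_eq_iff: "(1/2::real) ^ m = (1/2) ^ n \<longleftrightarrow> m = n"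
  by (simp add: power_one_over)

lemma half_power_le_iff: "(1/2::real) ^ m \<le> (1/2) ^ n \<longleftrightarrow> n \<le> m"
  by (rule power_decreasing_iff) auto

lemma cell_weight_le_1: "cell_weight L k c \<le> 1"
  by (induction k arbitrary: c) (auto simp: power_le_one simp del: power_Suc)

lemma cell_weight_ge_half_power: "cell_weight L k c \<noteq> 0 \<Longrightarrow> (1/2) ^ k \<le> cell_weight L k c"
proof (induction k arbitrary: c)
  case (Suc k)
  then show ?case
  proof (cases "c div side L k = 0")
    case False
    then have "(1/2) ^ k \<le> cell_weight L k (c mod side L k)" using Suc by (auto split: if_splits)
    moreover have "(1/2::real) ^ Suc k \<le> (1/2) ^ k" by (simp only: half_power_le_iff)
    ultimately have "(1/2) ^ Suc k \<le> cell_weight L k (c mod side L k)" by (rule order_trans[rotated])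
    then show ?thesis using False Suc.prems by (auto split: if_splits simp del: power_Suc)
  qed simp
qed (simp split: if_splits)

lemma cell_weight_values: "cell_weight L k c \<noteq> 0 \<Longrightarrow> cell_weight L k c = 1 \<or> (\<exists>j<k. cell_weight L k c = (1/2) ^ Suc j)"
proof (induction k arbitrary: c)
  case (Suc k)
  show ?case
  proof (cases "c div side L k = 0")
    case True
    then show ?thesis by auto
  next
    case False
    with Suc.prems have d: "c div side L k \<in> {2..int L + 1}" "cell_weight L k (c mod side L k) \<noteq> 0"
      by (auto split: if_splits)
    have "cell_weight L (Suc k) c = cell_weight L k (c mod side L k)" using False d(1) by simp
    then show ?thesis using Suc.IH[OF d(2)] less_SucI by metis
  qed
qed (simp split: if_splits)

lemma sum_shift_int: "(\<Sum>c\<in>{a + x..<a + y}. f c) = (\<Sum>r\<in>{x..<y::int}. f (a + r))"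
  by (rule sum.reindex_bij_witness[of _ "\<lambda>r. a + r" "\<lambda>c. c - a"]) auto

lemma sum_blocks:
  assumes "0 < S"
  shows "(\<Sum>c\<in>{0..<int M * S}. f c) = (\<Sum>d<M. \<Sum>r\<in>{0..<S}. f (int d * S + r))"
proof (induction M)
  case (Suc M)
  have "{0..<int (Suc M) * S} = {0..<int M * S} \<union> {int M * S + 0..<int M * S + S}"
    using assms ivl_disj_un_two(3)[of 0 "int M * S" "int M * S + S"] by (simp add: distrib_right add.commute)
  then have "(\<Sum>c\<in>{0..<int (Suc M) * S}. f c)
     = (\<Sum>c\<in>{0..<int M * S}. f c) + (\<Sum>c\<in>{int M * S + 0..<int M * S + S}. f c)"
    by (simp add: sum.union_disjoint)
  then show ?case using Suc by (simp only: sum_shift_int) simp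
qed simp

text \<open>
  From here on the recursion is used only through the decomposition of an index into block number and
  offset (cell_weight_block).
\<close>
declare cell_weight.simps(2) [simp del]

context
  fixes L :: nat
  assumes L: "4 \<le> L"
begin

lemma side_pos: "0 < side L k" using L by (simp add: side_def)

lemma side_mono: "j \<le> k \<Longrightarrow> side L j \<le> side L k"
  unfolding side_def using L by (intro power_increasing) auto

lemma cell_weight_block: "0 \<le> r \<Longrightarrow> r < side L k \<Longrightarrow> cell_weight L (Suc k) (d * side L k + r) =
    (if d = 0 then (1/2) ^ Suc k else if d \<in> {2..int L + 1} then cell_weight L k r else 0)"
  using side_pos[of k] by (simp add: cell_weight.simps(2))

lemma cell_weight_Suc_support:
  assumes "cell_weight L (Suc k) c \<noteq> 0"
  shows "0 \<le> c \<and> c < (int L + 2) * side L k"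
proof -
  have "c div side L k \<in> {0..int L + 1}" using assms L by (auto simp: cell_weight.simps(2) split: if_splits)
  then have "0 \<le> c div side L k" "c div side L k + 1 \<le> int L + 2" by auto
  moreover have "c = (c div side L k) * side L k + c mod side L k" by (rule div_mult_mod_eq[symmetric])
  moreover have "0 \<le> c mod side L k" "c mod side L k < side L k" using side_pos[of k] by auto
  moreover have "(c div side L k + 1) * side L k \<le> (int L + 2) * side L k"
    using calculation side_pos[of k] by (intro mult_right_mono) auto
  moreover have "0 \<le> (c div side L k) * side L k" using calculation side_pos[of k] by (intro mult_nonneg_nonneg) auto
  ultimately show ?thesis unfolding distrib_right by linarith
qed

lemma cell_weight_support:
  assumes "cell_weight L k c \<noteq> 0"
  shows "0 \<le> c \<and> c < side L k"
proof (cases k)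
  case 0
  then show ?thesis using assms by (simp split: if_splits)
next
  case (Suc j)
  have "(int L + 2) * side L j \<le> 2 * int L * side L j"
    using L side_pos[of j] by (intro mult_right_mono) auto
  moreover have "0 \<le> c \<and> c < (int L + 2) * side L j"
    using cell_weight_Suc_support[of j c] assms unfolding Suc by blast
  ultimately show ?thesis unfolding Suc side_Suc by linarith
qed

text \<open>
  A plateau of length (2L)^j is at least that far from everything denser. At its own level this is
  due to the empty cells around it. At higher levels only a neighbouring copy could come into play,
  and its last quarter is empty.
\<close>
lemma cell_weight_nearby:
  assumes "cell_weight L k c = (1/2) ^ Suc j" "\<bar>c' - c\<bar> \<le> side L j"
  shows "cell_weight L k c' \<le> cell_weight L k c"
  using assms
proof (induction k arbitrary: c c')
  case 0
  then have "(1/2::real) ^ Suc j = (1/2) ^ 0 \<or> (1/2::real) ^ Suc j = 0" by (auto split: if_splits)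
  then show ?case by (simp only: half_power_eq_iff) simp
next
  case (Suc k)
  let ?S = "side L k"
  define d where "d = c div ?S"
  define r where "r = c mod ?S"
  define d' where "d' = c' div ?S"
  define r' where "r' = c' mod ?S"
  have S: "0 < ?S" by (rule side_pos)
  have c: "c = d * ?S + r" "0 \<le> r" "r < ?S" using S by (auto simp: d_def r_def div_mult_mod_eq)
  have c': "c' = d' * ?S + r'" "0 \<le> r'" "r' < ?S" using S by (auto simp: d'_def r'_def div_mult_mod_eq)
  have w: "cell_weight L (Suc k) c = (if d = 0 then (1/2) ^ Suc k else if d \<in> {2..int L + 1} then cell_weight L k r else 0)"
    unfolding c(1) using c by (intro cell_weight_block) auto
  have w': "cell_weight L (Suc k) c' = (if d' = 0 then (1/2) ^ Suc k else if d' \<in> {2..int L + 1} then cell_weight L k r' else 0)"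
    unfolding c'(1) using c' by (intro cell_weight_block) auto
  show ?case
  proof (cases "d = 0")
    case True
    then have "(1/2::real) ^ Suc k = (1/2) ^ Suc j" using w Suc.prems by simp
    then have jk: "j = k" by (simp only: half_power_eq_iff)
    have cc: "\<bar>c' - c\<bar> \<le> ?S" "c = r" using Suc.prems(2) jk c(1) True by simp_all
    have "(- 2) * ?S < d' * ?S" "d' * ?S < 2 * ?S"
      using cc c(2,3) c' by linarith+
    then have "d' < 2" "-2 < d'" using mult_right_less_imp_less[of _ ?S] less_imp_le[OF S] by blast+
    then show ?thesis using w w' True cell_weight_nonneg[of L "Suc k" c] by (auto simp del: power_Suc)
  next
    case False
    have "cell_weight L (Suc k) c \<noteq> 0" unfolding Suc.prems(1) by simp
    then have d: "d \<in> {2..int L + 1}" "cell_weight L k r \<noteq> 0" "cell_weight L (Suc k) c = cell_weight L k r"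
      using w False by (auto split: if_splits)
    have wr: "cell_weight L k r = (1/2) ^ Suc j" using d Suc.prems by simp
    have "(1/2::real) ^ k \<le> (1/2) ^ Suc j" using cell_weight_ge_half_power[OF d(2)] wr by simp
    \<comment> \<open>So the plateau containing c is no longer than a block of the copy in which it lies.\<close>
    then have jk: "Suc j \<le> k" by (simp only: half_power_le_iff)
    then obtain i where i: "k = Suc i" "j \<le> i" by (cases k) auto
    let ?s = "side L i"
    have s: "0 < ?s" by (rule side_pos)
    have Ss: "?S = 2 * int L * ?s" using i by (simp add: side_Suc)
    have js: "side L j \<le> ?s" using i by (intro side_mono) auto
    have r: "r < (int L + 2) * ?s" using cell_weight_Suc_support[of i r] d i by simp
    have big: "4 * ?s \<le> int L * ?s" using L s by (intro mult_right_mono) auto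
    have "?S = int L * ?s + int L * ?s" unfolding Ss by (simp add: algebra_simps)
    then have big2: "(int L + 2) * ?s \<le> ?S - ?s" "?s < ?S" unfolding distrib_right using big s by linarith+
    have diff: "\<bar>c' - c\<bar> \<le> ?s" using Suc.prems(2) js by simp
    show ?thesis
    proof (cases "d' = d")
      case True
      have "\<bar>r' - r\<bar> \<le> side L j" using Suc.prems(2) c c' True by simp
      then have "cell_weight L k r' \<le> cell_weight L k r" using Suc.IH[OF wr] by simp
      then show ?thesis using w' d True False by simp
    next
      case ne: False
      have "cell_weight L (Suc k) c' = 0"
      proof (cases "d' < d")
        case True
        have "(d' + 1) * ?S \<le> d * ?S" using True S by (intro mult_right_mono) auto
        then have "r' \<ge> ?S - ?s" using diff c c' by (simp add: distrib_right abs_le_iff)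
        then have "r' \<ge> (int L + 2) * ?s" using big2 by linarith
        moreover have "d' \<noteq> 0"
        proof
          assume "d' = 0"
          then have "c' < ?S" using c' by simp
          moreover have "2 * ?S \<le> d * ?S" using d S by (intro mult_right_mono) auto
          ultimately show False using diff c big2 by linarith
        qed
        moreover have "cell_weight L k r' = 0" using cell_weight_Suc_support[of i r'] i calculation(1) by fastforce
        ultimately show ?thesis using w' by simp
      next
        case False
        then have "(d + 1) * ?S \<le> d' * ?S" using ne S by (intro mult_right_mono) auto
        then have "r \<ge> ?S - ?s" using diff c c' by (simp add: distrib_right abs_le_iff)
        then have "r \<ge> (int L + 2) * ?s" using big2 by linarith
        then show ?thesis using r by simp
      qed
      then show ?thesis using cell_weight_nonneg by simp
    qed
  qed
qed

text \<open>
  The full cells have mass L^k in total, and the plateaus of each level carry 1/(2L) times that mass.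
  With at most 2L levels the plateaus thus at most double the mass.
\<close>
lemma cell_weight_mass: "(\<Sum>c\<in>{0..<side L k}. cell_weight L k c) = real L ^ k * (1 + real k / (2 * real L))"
proof (induction k)
  case (Suc k)
  let ?S = "side L k"
  have S: "0 < ?S" by (rule side_pos)
  have "(\<Sum>c\<in>{0..<side L (Suc k)}. cell_weight L (Suc k) c) = (\<Sum>c\<in>{0..<int (2 * L) * ?S}. cell_weight L (Suc k) c)"
    by (simp add: side_Suc)
  also have "\<dots> = (\<Sum>d<2*L. \<Sum>r\<in>{0..<?S}. cell_weight L (Suc k) (int d * ?S + r))"
    by (rule sum_blocks[OF S])
  also have "\<dots> = (\<Sum>d<2*L. \<Sum>r\<in>{0..<?S}. (if int d = 0 then (1/2) ^ Suc k else if int d \<in> {2..int L + 1} then cell_weight L k r else 0))"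
    by (intro sum.cong refl cell_weight_block) auto
  also have "\<dots> = (\<Sum>d<2*L. (if d = 0 then of_int ?S * (1/2) ^ Suc k else 0) +
       (if d \<in> {2..L+1} then (\<Sum>r\<in>{0..<?S}. cell_weight L k r) else 0))"
  proof (intro sum.cong refl)
    fix d assume "d \<in> {..<2*L}"
    show "(\<Sum>r\<in>{0..<?S}. (if int d = 0 then (1/2) ^ Suc k else if int d \<in> {2..int L + 1} then cell_weight L k r else 0))
     = (if d = 0 then of_int ?S * (1/2) ^ Suc k else 0) + (if d \<in> {2..L+1} then (\<Sum>r\<in>{0..<?S}. cell_weight L k r) else 0)"
      using S by (cases "d = 0"; cases "d \<in> {2..L+1}") auto
  qed
  also have "\<dots> = of_int ?S * (1/2) ^ Suc k + real (card ({..<2*L} \<inter> {2..L+1})) * (\<Sum>r\<in>{0..<?S}. cell_weight L k r)"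
    using L by (simp add: sum.distrib sum.delta sum.If_cases Int_def)
  also have "{..<2*L} \<inter> {2..L+1} = {2..L+1}" using L by auto
  also have "of_int ?S * (1/2::real) ^ Suc k = real L ^ k / 2"
    by (simp add: side_def power_mult_distrib power_one_over)
  finally show ?case using L Suc by (simp add: field_simps)
qed simp

text \<open>
  The average density over a grid cell of length (2L)^j is at most 2^(1-j), no matter where the cell
  lies: it is either inside one plateau, or a complete copy of the pattern of level j, or empty.
\<close>
lemma cell_weight_grid_mass:
  assumes "j \<le> k" "k \<le> 2 * L"
  shows "(\<Sum>c\<in>{a * side L j..<(a + 1) * side L j}. cell_weight L k c) \<le> 2 * real L ^ j"
  using assms
proof (induction k arbitrary: a)
  case 0
  then show ?case by simp
next
  case (Suc k)
  show ?case
  proof (cases "j = Suc k")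
    case True
    let ?S = "side L j"
    have S: "0 < ?S" by (rule side_pos)
    show ?thesis
    proof (cases "a = 0")
      case True
      have "real (Suc k) / (2 * real L) \<le> 1" using Suc.prems L by simp
      then have "real L ^ Suc k * (1 + real (Suc k) / (2 * real L)) \<le> real L ^ Suc k * 2" by (intro mult_left_mono) auto
      then show ?thesis using cell_weight_mass[of "Suc k"] True \<open>j = Suc k\<close> by (simp only: mult.commute) simp
    next
      case False
      have "cell_weight L (Suc k) c = 0" if "c \<in> {a * ?S..<(a + 1) * ?S}" for c
      proof (rule ccontr)
        assume "cell_weight L (Suc k) c \<noteq> 0"
        then have "0 \<le> c \<and> c < side L (Suc k)" by (rule cell_weight_support)
        then have "0 \<le> c" "c < ?S" unfolding \<open>j = Suc k\<close> by blast+
        then have "0 * ?S < (a + 1) * ?S" "a * ?S < 1 * ?S"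
          using that unfolding atLeastLessThan_iff by linarith+
        then have "0 < a + 1" "a < 1" using S mult_right_less_imp_less[of _ ?S] by (blast intro: less_imp_le)+
        then show False using False by simp
      qed
      then show ?thesis by simp
    qed
  next
    case False
    then have jk: "j \<le> k" "k \<le> 2 * L" using Suc.prems by auto
    let ?S = "side L k" and ?s = "side L j"
    have S: "0 < ?S" and s: "0 < ?s" by (rule side_pos)+
    define m where "m = side L (k - j)"
    have m: "0 < m" unfolding m_def by (rule side_pos)
    have Sm: "?S = m * ?s" using jk unfolding m_def side_def power_add[symmetric] by simp
    define d where "d = a div m"
    define b where "b = a mod m"
    \<comment> \<open>The grid cell lies in a single block d, where it has number b among m.\<close>
    have b: "0 \<le> b" "b + 1 \<le> m" "a = d * m + b" using m by (auto simp: b_def d_def add1_zle_eq)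
    have ran: "a * ?s = d * ?S + b * ?s" "(a + 1) * ?s = d * ?S + (b + 1) * ?s"
      unfolding Sm b(3) by (auto simp: algebra_simps)
    have "(b + 1) * ?s \<le> m * ?s" using b s by (intro mult_right_mono) auto
    then have le: "(b + 1) * ?s \<le> ?S" "0 \<le> b * ?s" using Sm b s by auto
    have "(\<Sum>c\<in>{a * ?s..<(a + 1) * ?s}. cell_weight L (Suc k) c) = (\<Sum>r\<in>{b * ?s..<(b + 1) * ?s}. cell_weight L (Suc k) (d * ?S + r))"
      unfolding ran by (rule sum_shift_int)
    also have "\<dots> = (\<Sum>r\<in>{b * ?s..<(b + 1) * ?s}. (if d = 0 then (1/2) ^ Suc k else if d \<in> {2..int L + 1} then cell_weight L k r else 0))"
      using le by (intro sum.cong refl cell_weight_block) auto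
    also have "\<dots> \<le> 2 * real L ^ j"
    proof -
      have "of_int ?s * (1/2::real) ^ Suc k \<le> of_int ?s * (1/2) ^ j"
        using s jk by (intro mult_left_mono power_decreasing) auto
      also have "\<dots> = real L ^ j" by (simp add: side_def power_mult_distrib power_one_over)
      also have "\<dots> \<le> 2 * real L ^ j" by simp
      finally have "of_int ?s * (1/2::real) ^ Suc k \<le> 2 * real L ^ j" .
      moreover have "real (nat ((b + 1) * ?s - b * ?s)) = of_int ?s" using s by (simp add: algebra_simps)
      ultimately have "(\<Sum>r\<in>{b * ?s..<(b + 1) * ?s}. (1/2::real) ^ Suc k) \<le> 2 * real L ^ j"
        by (simp only: sum_constant card_atLeastLessThan_int)
      then show ?thesis using Suc.IH[OF jk, of b]
        by (cases "d = 0"; cases "d \<in> {2..int L + 1}") (simp_all only: if_True if_False sum.neutral_const, auto)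
    qed
    finally show ?thesis .
  qed
qed

end

section \<open>The interaction of plateaus and full cells\<close>

text \<open>
  The full cells carry the density 1 at the bottom of the hierarchy; the edge cells make up the
  plateaus, which sit at the left edges of the intervals.
\<close>
definition full_cells :: "nat \<Rightarrow> nat \<Rightarrow> int set" where "full_cells L k = {c. cell_weight L k c = 1}"
definition edge_cells :: "nat \<Rightarrow> nat \<Rightarrow> int set" where "edge_cells L k = {c. 0 < cell_weight L k c \<and> cell_weight L k c < 1}"

definition copies :: "nat \<Rightarrow> nat \<Rightarrow> int set \<Rightarrow> int set" where
  "copies L k A = (\<Union>d\<in>{2..int L + 1}. (\<lambda>r. d * side L k + r) ` A)"

lemma sum_inverse_squares_le: "(\<Sum>m=1..n. 1 / (real m)\<^sup>2) \<le> 2 - 1 / real n"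
proof (induction n)
  case (Suc n)
  show ?case
  proof (cases "n = 0")
    case False
    have "1 / (real (Suc n))\<^sup>2 \<le> 1 / real n - 1 / real (Suc n)"
      using False by (simp add: divide_simps power2_eq_square)
    then show ?thesis using Suc by simp
  qed simp
qed simp

lemma sum_inverse_squares_inj_le:
  fixes h :: "'a \<Rightarrow> nat"
  assumes "finite P" "inj_on h P" "\<And>x. x \<in> P \<Longrightarrow> 1 \<le> h x"
  shows "(\<Sum>x\<in>P. 1 / (real (h x))\<^sup>2) \<le> 2"
proof -
  obtain n where n: "\<forall>m\<in>h ` P. m \<le> n"
    using assms(1) finite_nat_set_iff_bounded_le[of "h ` P"] by auto
  have "(\<Sum>x\<in>P. 1 / (real (h x))\<^sup>2) = (\<Sum>m\<in>h ` P. 1 / (real m)\<^sup>2)"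
    using assms(2) by (simp add: sum.reindex)
  also have "\<dots> \<le> (\<Sum>m=1..n. 1 / (real m)\<^sup>2)"
    using n assms by (intro sum_mono2) auto
  also have "\<dots> \<le> 2 - 1 / real n" by (rule sum_inverse_squares_le)
  also have "\<dots> \<le> 2" by simp
  finally show ?thesis .
qed

lemma sum_inverse_squares_neighbours:
  fixes D :: "int set"
  assumes "finite D"
  shows "(\<Sum>d'\<in>D - {d}. 1 / (real_of_int (d' - d))\<^sup>2) \<le> 4"
proof -
  have sq: "(real_of_int (d' - d))\<^sup>2 = (real (nat \<bar>d' - d\<bar>))\<^sup>2" for d'
    by simp
  have "D - {d} = {d'\<in>D. d < d'} \<union> {d'\<in>D. d' < d}" by auto
  then have "(\<Sum>d'\<in>D - {d}. 1 / (real_of_int (d' - d))\<^sup>2)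
    = (\<Sum>d'\<in>{d'\<in>D. d < d'} \<union> {d'\<in>D. d' < d}. 1 / (real (nat \<bar>d' - d\<bar>))\<^sup>2)"
    by (intro sum.cong) (simp_all only: sq)
  also have "\<dots> = (\<Sum>d'\<in>{d'\<in>D. d < d'}. 1 / (real (nat \<bar>d' - d\<bar>))\<^sup>2) + (\<Sum>d'\<in>{d'\<in>D. d' < d}. 1 / (real (nat \<bar>d' - d\<bar>))\<^sup>2)"
    using assms by (intro sum.union_disjoint) auto
  also have "\<dots> \<le> 2 + 2"
    using assms by (intro add_mono sum_inverse_squares_inj_le) (auto simp: inj_on_def)
  finally show ?thesis by simp
qed

text \<open>
  For x in [c, c+1) and y in [e, e+1) with c and e not adjacent, 1/(y-x) is at most 1/(e-c-1). With
  m = 0 this sum thus bounds from above the Hilbert transform of the plateaus summed over the full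
  cells; general m describes the action of one copy of the pattern on another one, m steps away.
\<close>
definition pairing :: "nat \<Rightarrow> nat \<Rightarrow> int \<Rightarrow> real" where
  "pairing L k m = (\<Sum>c\<in>full_cells L k. \<Sum>e\<in>edge_cells L k. 1 / of_int (m * side L k + e - c - 1))"

text \<open>
  The effect of one plateau on the copies in its own interval, whose block d reaches at most d+1 cells
  away; up to a constant this is log L.
\<close>
definition gain :: "nat \<Rightarrow> real" where
  "gain L = (\<Sum>d\<in>{2..int L + 1}. 1 / (of_int d + 1))"

context
  fixes L :: nat
  assumes L: "4 \<le> L"
begin

lemma full_cells_Suc: "full_cells L (Suc k) = copies L k (full_cells L k)"
proof (intro set_eqI iffI)
  fix c
  define d where "d = c div side L k"
  define r where "r = c mod side L k"
  have c: "c = d * side L k + r" "0 \<le> r" "r < side L k" using side_pos[OF L, of k] by (auto simp: d_def r_def div_mult_mod_eq)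
  have w: "cell_weight L (Suc k) c = (if d = 0 then (1/2) ^ Suc k else if d \<in> {2..int L + 1} then cell_weight L k r else 0)"
    unfolding c(1) using c by (intro cell_weight_block[OF L]) auto
  have ne1: "(1/2::real) ^ Suc k \<noteq> 1" using half_power_eq_iff[of "Suc k" 0] by simp
  assume "c \<in> full_cells L (Suc k)"
  then have "d \<in> {2..int L + 1}" "r \<in> full_cells L k" using w ne1 by (auto simp: full_cells_def split: if_splits)
  then show "c \<in> copies L k (full_cells L k)" using c(1) by (auto simp: copies_def)
next
  fix c assume "c \<in> copies L k (full_cells L k)"
  then obtain d r where d: "d \<in> {2..int L + 1}" "r \<in> full_cells L k" "c = d * side L k + r" by (auto simp: copies_def)
  then have "0 \<le> r \<and> r < side L k" by (intro cell_weight_support[OF L]) (simp add: full_cells_def)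
  then have "cell_weight L (Suc k) c = cell_weight L k r" unfolding d(3) using d by (subst cell_weight_block[OF L]) auto
  then show "c \<in> full_cells L (Suc k)" using d by (simp add: full_cells_def)
qed

lemma edge_cells_Suc: "edge_cells L (Suc k) = {0..<side L k} \<union> copies L k (edge_cells L k)"
proof (intro set_eqI iffI)
  fix c
  define d where "d = c div side L k"
  define r where "r = c mod side L k"
  have c: "c = d * side L k + r" "0 \<le> r" "r < side L k" using side_pos[OF L, of k] by (auto simp: d_def r_def div_mult_mod_eq)
  have w: "cell_weight L (Suc k) c = (if d = 0 then (1/2) ^ Suc k else if d \<in> {2..int L + 1} then cell_weight L k r else 0)"
    unfolding c(1) using c by (intro cell_weight_block[OF L]) auto
  assume "c \<in> edge_cells L (Suc k)"
  then have "d = 0 \<or> d \<in> {2..int L + 1} \<and> r \<in> edge_cells L k" using w by (auto simp: edge_cells_def split: if_splits)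
  then show "c \<in> {0..<side L k} \<union> copies L k (edge_cells L k)" using c by (auto simp: copies_def)
next
  fix c assume "c \<in> {0..<side L k} \<union> copies L k (edge_cells L k)"
  then show "c \<in> edge_cells L (Suc k)"
  proof
    assume "c \<in> {0..<side L k}"
    then have "cell_weight L (Suc k) (0 * side L k + c) = (1/2) ^ Suc k" by (subst cell_weight_block[OF L]) auto
    moreover have "(1/2::real) ^ Suc k < 1" by (rule power_Suc_less_one) auto
    ultimately show ?thesis by (simp add: edge_cells_def del: power_Suc)
  next
    assume "c \<in> copies L k (edge_cells L k)"
    then obtain d r where d: "d \<in> {2..int L + 1}" "r \<in> edge_cells L k" "c = d * side L k + r" by (auto simp: copies_def)
    then have "0 \<le> r \<and> r < side L k" by (intro cell_weight_support[OF L]) (simp add: edge_cells_def)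
    then have "cell_weight L (Suc k) c = cell_weight L k r" unfolding d(3) using d by (subst cell_weight_block[OF L]) auto
    then show "c \<in> edge_cells L (Suc k)" using d by (simp add: edge_cells_def)
  qed
qed

lemma full_cells_bound: "full_cells L k \<subseteq> {0..<side L k}"
proof
  fix c assume "c \<in> full_cells L k"
  then have "cell_weight L k c \<noteq> 0" by (simp add: full_cells_def)
  then show "c \<in> {0..<side L k}" using cell_weight_support[OF L] by simp
qed

lemma edge_cells_bound: "edge_cells L k \<subseteq> {0..<side L k}"
proof
  fix c assume "c \<in> edge_cells L k"
  then have "cell_weight L k c \<noteq> 0" by (simp add: edge_cells_def)
  then show "c \<in> {0..<side L k}" using cell_weight_support[OF L] by simp
qed

lemma finite_full_cells: "finite (full_cells L k)" using full_cells_bound finite_subset by blast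
lemma finite_edge_cells: "finite (edge_cells L k)" using edge_cells_bound finite_subset by blast

lemma sum_copies:
  fixes f :: "int \<Rightarrow> real"
  assumes A: "A \<subseteq> {0..<side L k}"
  shows "sum f (copies L k A) = (\<Sum>d\<in>{2..int L + 1}. \<Sum>r\<in>A. f (d * side L k + r))"
proof -
  have fin: "finite A" using A finite_subset by blast
  have "sum f (copies L k A) = (\<Sum>d\<in>{2..int L + 1}. sum f ((\<lambda>r. d * side L k + r) ` A))"
    unfolding copies_def
  proof (rule sum.UNION_disjoint)
    show "\<forall>d\<in>{2..int L + 1}. \<forall>d'\<in>{2..int L + 1}. d \<noteq> d' \<longrightarrow>
       (\<lambda>r. d * side L k + r) ` A \<inter> (\<lambda>r. d' * side L k + r) ` A = {}"
    proof (intro ballI impI)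
      fix d d' :: int assume "d \<noteq> d'"
      have "x div side L k = d" if "x \<in> (\<lambda>r. d * side L k + r) ` A" for x d
        using A that side_pos[OF L, of k] by auto
      then show "(\<lambda>r. d * side L k + r) ` A \<inter> (\<lambda>r. d' * side L k + r) ` A = {}"
        unfolding disjoint_iff using \<open>d \<noteq> d'\<close> by metis
    qed
  qed (use fin in auto)
  also have "\<dots> = (\<Sum>d\<in>{2..int L + 1}. \<Sum>r\<in>A. f (d * side L k + r))"
    by (rule sum.cong[OF refl], subst sum.reindex) (auto simp: inj_on_def)
  finally show ?thesis .
qed

lemma sum_full_cells_Suc:
  fixes f :: "int \<Rightarrow> real"
  shows "sum f (full_cells L (Suc k)) = (\<Sum>d\<in>{2..int L + 1}. \<Sum>r\<in>full_cells L k. f (d * side L k + r))"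
  unfolding full_cells_Suc by (rule sum_copies[OF full_cells_bound])

lemma copies_ge: "A \<subseteq> {0..<side L k} \<Longrightarrow> c \<in> copies L k A \<Longrightarrow> 2 * side L k \<le> c"
proof -
  assume A: "A \<subseteq> {0..<side L k}" "c \<in> copies L k A"
  then obtain d r where d: "d \<in> {2..int L + 1}" "r \<in> A" "c = d * side L k + r" by (auto simp: copies_def)
  then have "0 \<le> r" using A by auto
  have "2 * side L k \<le> d * side L k" using d side_pos[OF L, of k] by (intro mult_right_mono) auto
  then show ?thesis using d \<open>0 \<le> r\<close> by simp
qed

lemma sum_edge_cells_Suc:
  fixes f :: "int \<Rightarrow> real"
  shows "sum f (edge_cells L (Suc k)) = (\<Sum>r\<in>{0..<side L k}. f r) + (\<Sum>d\<in>{2..int L + 1}. \<Sum>r\<in>edge_cells L k. f (d * side L k + r))"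
proof -
  have "{0..<side L k} \<inter> copies L k (edge_cells L k) = {}"
    using side_pos[OF L, of k] by (auto dest: copies_ge[OF edge_cells_bound])
  moreover have "finite (copies L k (edge_cells L k))" using finite_edge_cells[of "Suc k"] unfolding edge_cells_Suc by simp
  ultimately show ?thesis
    unfolding edge_cells_Suc by (simp add: sum.union_disjoint sum_copies[OF edge_cells_bound])
qed

lemma card_full_cells: "real (card (full_cells L k)) = real L ^ k"
proof (induction k)
  case 0
  have "full_cells L 0 = {0}" by (auto simp: full_cells_def)
  then show ?case by simp
next
  case (Suc k)
  have "real (card (full_cells L (Suc k))) = (\<Sum>d\<in>{2..int L + 1}. real (card (full_cells L k)))"
    using sum_full_cells_Suc[of "\<lambda>_. 1" k] by simp
  then show ?case using Suc by simp
qed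

lemma card_edge_cells: "real L * real (card (edge_cells L k)) \<le> of_int (side L k)"
proof (induction k)
  case 0
  have "edge_cells L 0 = {}" by (auto simp: edge_cells_def)
  then show ?case by simp
next
  case (Suc k)
  have "real (card (edge_cells L (Suc k))) = of_int (side L k) + real L * real (card (edge_cells L k))"
    using sum_edge_cells_Suc[of "\<lambda>_. 1" k] side_pos[OF L, of k] by simp
  also have "\<dots> \<le> 2 * of_int (side L k)" using Suc by simp
  finally have "real L * real (card (edge_cells L (Suc k))) \<le> real L * (2 * of_int (side L k))"
    by (rule mult_left_mono) simp
  then show ?case by (simp add: side_Suc)
qed

text \<open>
  The pattern is contained in the first L+2 of the 2L blocks, that is in at most three quarters of
  its interval, as L is at least 4. So two copies never come close to each other.
\<close>
lemma offset_bound: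
  assumes "c \<in> full_cells L k" "e \<in> edge_cells L k"
  shows "\<bar>real_of_int (e - c - 1)\<bar> \<le> 3 / 4 * of_int (side L k)"
proof (cases k)
  case 0
  then show ?thesis using assms by (simp add: edge_cells_def split: if_splits)
next
  case (Suc j)
  let ?s = "side L j"
  have "0 \<le> c \<and> c < (int L + 2) * ?s" "0 \<le> e \<and> e < (int L + 2) * ?s"
    using assms cell_weight_Suc_support[OF L, of j] by (auto simp: full_cells_def edge_cells_def Suc)
  then have "\<bar>e - c - 1\<bar> \<le> (int L + 2) * ?s" by linarith
  then have "real_of_int \<bar>e - c - 1\<bar> \<le> real_of_int ((int L + 2) * ?s)" by (rule of_int_le_iff[THEN iffD2])
  then have "\<bar>real_of_int (e - c - 1)\<bar> \<le> (real L + 2) * of_int ?s" by simp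
  also have "\<dots> \<le> (3/2 * real L) * of_int ?s"
    using L side_pos[OF L, of j] by (intro mult_right_mono) auto
  finally show ?thesis by (simp add: Suc side_Suc)
qed

text \<open>
  Two copies act on each other with opposite signs. With x the displacement and s the offset of two
  cells, 1/(x+s) + 1/(s-x) equals -2s/(x^2 - s^2), which decays quadratically in m. The small total
  length of the plateaus, at most 1/L of the interval, then cancels the factor L.
\<close>
lemma pairing_pair:
  assumes "m \<noteq> 0"
  shows "real L * (pairing L k m + pairing L k (- m)) \<le> 4 * real L ^ k / (of_int m)\<^sup>2"
proof -
  let ?S = "real_of_int (side L k)"
  have S: "0 < ?S" using side_pos[OF L, of k] by simp
  have "pairing L k m + pairing L k (- m)
    = (\<Sum>c\<in>full_cells L k. \<Sum>e\<in>edge_cells L k. 1 / of_int (m * side L k + e - c - 1) + 1 / of_int (- m * side L k + e - c - 1))"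
    by (simp add: pairing_def sum.distrib)
  also have "\<dots> \<le> (\<Sum>c\<in>full_cells L k. \<Sum>e\<in>edge_cells L k. 4 / (?S * (of_int m)\<^sup>2))"
  proof (intro sum_mono)
    fix c e assume ce: "c \<in> full_cells L k" "e \<in> edge_cells L k"
    define s where "s = real_of_int (e - c - 1)"
    define x where "x = real_of_int m * ?S"
    have s: "\<bar>s\<bar> \<le> 3/4 * ?S" using offset_bound[OF ce] by (simp add: s_def)
    have m1: "1 \<le> \<bar>real_of_int m\<bar>" using assms by linarith
    have "\<bar>x\<bar> = \<bar>real_of_int m\<bar> * ?S" using S by (simp add: x_def abs_mult)
    then have xS: "?S \<le> \<bar>x\<bar>" using mult_right_mono[OF m1, of ?S] S by simp
    have s2: "s\<^sup>2 \<le> 9/16 * x\<^sup>2"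
    proof -
      have "\<bar>s\<bar> \<le> \<bar>3/4 * x\<bar>" using s xS by (simp add: abs_mult)
      then have "s\<^sup>2 \<le> (3/4 * x)\<^sup>2" by (simp only: abs_le_square_iff)
      then show ?thesis by (simp add: power2_eq_square)
    qed
    have x2: "0 < x\<^sup>2" using xS S by auto
    have ne: "x + s \<noteq> 0" "s - x \<noteq> 0" using s xS S by auto
    have "1 / (x + s) + 1 / (s - x) = 2 * s / ((x + s) * (s - x))"
      using ne by (simp add: add_frac_eq)
    also have "(x + s) * (s - x) = - (x\<^sup>2 - s\<^sup>2)" by (simp add: power2_eq_square algebra_simps)
    also have "2 * s / - (x\<^sup>2 - s\<^sup>2) = (- 2 * s) / (x\<^sup>2 - s\<^sup>2)"
      unfolding divide_minus_right by simp
    also have "\<dots> \<le> (3/2 * ?S) / (7/16 * x\<^sup>2)"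
      using s s2 x2 S by (intro frac_le) auto
    also have "\<dots> = (24/7) / (?S * (of_int m)\<^sup>2)"
      using S assms by (simp add: x_def power_mult_distrib power2_eq_square)
    also have "\<dots> \<le> 4 / (?S * (of_int m)\<^sup>2)" using S by (intro divide_right_mono) auto
    finally show "1 / of_int (m * side L k + e - c - 1) + 1 / of_int (- m * side L k + e - c - 1) \<le> 4 / (?S * (of_int m)\<^sup>2)"
      by (simp add: x_def s_def algebra_simps)
  qed
  also have "\<dots> = real L ^ k * (real (card (edge_cells L k)) * (4 / (?S * (of_int m)\<^sup>2)))"
    using card_full_cells[of k] by simp
  finally have "real L * (pairing L k m + pairing L k (- m)) \<le> real L * (real L ^ k * (real (card (edge_cells L k)) * (4 / (?S * (of_int m)\<^sup>2))))"
    by (rule mult_left_mono) simp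
  also have "\<dots> = real L ^ k * (4 / (?S * (of_int m)\<^sup>2)) * (real L * real (card (edge_cells L k)))" by simp
  also have "\<dots> \<le> real L ^ k * (4 / (?S * (of_int m)\<^sup>2)) * ?S"
    using S by (intro mult_left_mono card_edge_cells) auto
  also have "\<dots> = 4 * real L ^ k / (of_int m)\<^sup>2" using S by simp
  finally show ?thesis .
qed

text \<open>
  Passing one level up produces L copies of the old interaction, the interaction between different
  copies, which is bounded by pairing_pair and a convergent sum, and the action of the new plateau,
  which lies to the left of all copies and therefore has a definite sign.
\<close>
lemma pairing_Suc:
  "pairing L (Suc k) 0 \<le> real L * pairing L k 0 + 8 * real L ^ k - real L ^ k * gain L"
proof -
  let ?D = "{2..int L + 1}" and ?S = "side L k"
  have S: "0 < ?S" by (rule side_pos[OF L])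
  define J where "J = (\<Sum>d\<in>?D. \<Sum>c\<in>full_cells L k. \<Sum>e\<in>{0..<?S}. 1 / real_of_int (e - (d * ?S + c) - 1))"
  define X where "X = (\<Sum>d\<in>?D. \<Sum>d'\<in>?D. pairing L k (d' - d))"
  have "pairing L (Suc k) 0 = (\<Sum>d\<in>?D. \<Sum>c\<in>full_cells L k. (\<Sum>e\<in>{0..<?S}. 1 / real_of_int (e - (d * ?S + c) - 1))
      + (\<Sum>d'\<in>?D. \<Sum>e\<in>edge_cells L k. 1 / real_of_int ((d' * ?S + e) - (d * ?S + c) - 1)))"
    unfolding pairing_def by (simp add: sum_full_cells_Suc sum_edge_cells_Suc)
  also have "\<dots> = J + (\<Sum>d\<in>?D. \<Sum>c\<in>full_cells L k. \<Sum>d'\<in>?D. \<Sum>e\<in>edge_cells L k. 1 / real_of_int ((d' * ?S + e) - (d * ?S + c) - 1))"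
    by (simp add: J_def sum.distrib)
  also have "(\<Sum>d\<in>?D. \<Sum>c\<in>full_cells L k. \<Sum>d'\<in>?D. \<Sum>e\<in>edge_cells L k. 1 / real_of_int ((d' * ?S + e) - (d * ?S + c) - 1)) = X"
    unfolding X_def pairing_def
    by (rule sum.cong[OF refl], subst sum.swap, intro sum.cong refl) (simp add: algebra_simps)
  finally have split: "pairing L (Suc k) 0 = J + X" .
  have "J \<le> (\<Sum>d\<in>?D. real L ^ k * - (1 / (of_int d + 1)))"
    unfolding J_def
  proof (rule sum_mono)
    fix d assume d: "d \<in> ?D"
    have "(\<Sum>c\<in>full_cells L k. \<Sum>e\<in>{0..<?S}. 1 / real_of_int (e - (d * ?S + c) - 1))
        \<le> (\<Sum>c\<in>full_cells L k. \<Sum>e\<in>{0..<?S}. - (1 / (of_int ((d + 1) * ?S))))"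
    proof (intro sum_mono)
      fix c e assume c: "c \<in> full_cells L k" and e: "e \<in> {0..<?S}"
      have c': "0 \<le> c" "c < ?S" using subsetD[OF full_cells_bound c] by auto
      have "2 * ?S \<le> d * ?S" using d S by (intro mult_right_mono) auto
      then have y: "0 < d * ?S + c + 1 - e" "d * ?S + c + 1 - e \<le> (d + 1) * ?S"
        using c' e S unfolding atLeastLessThan_iff distrib_right by linarith+
      define y where "y = d * ?S + c + 1 - e"
      have "1 / real_of_int ((d + 1) * ?S) \<le> 1 / real_of_int y"
        using y by (intro divide_left_mono) (auto simp: y_def simp del: of_int_mult of_int_add intro!: mult_pos_pos)
      moreover have "e - (d * ?S + c) - 1 = - y" by (simp add: y_def)
      ultimately show "1 / real_of_int (e - (d * ?S + c) - 1) \<le> - (1 / (of_int ((d + 1) * ?S)))"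
        by (simp only: of_int_minus)
    qed
    also have "\<dots> = real L ^ k * - (1 / (of_int d + 1))"
    proof -
      have "real_of_int ?S * (1 / of_int ((d + 1) * ?S)) = 1 / (of_int d + 1)" using S by simp
      moreover have "(\<Sum>c\<in>full_cells L k. \<Sum>e\<in>{0..<?S}. - (1 / (real_of_int ((d + 1) * ?S))))
         = real (card (full_cells L k)) * - (real_of_int ?S * (1 / of_int ((d + 1) * ?S)))"
        using S by (simp del: of_int_mult)
      ultimately show ?thesis by (simp only: card_full_cells)
    qed
    finally show "(\<Sum>c\<in>full_cells L k. \<Sum>e\<in>{0..<?S}. 1 / real_of_int (e - (d * ?S + c) - 1)) \<le> real L ^ k * - (1 / (of_int d + 1))" .
  qed
  also have "\<dots> = - (real L ^ k * gain L)" by (simp add: gain_def sum_distrib_left sum_negf)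
  finally have Jle: "J \<le> - (real L ^ k * gain L)" .
  \<comment> \<open>Exchanging d and d' pairs every displacement with its opposite.\<close>
  have "X = (\<Sum>d\<in>?D. \<Sum>d'\<in>?D. pairing L k (d - d'))" unfolding X_def by (rule sum.swap)
  then have "2 * X = (\<Sum>d\<in>?D. \<Sum>d'\<in>?D. pairing L k (d' - d) + pairing L k (- (d' - d)))"
    by (simp add: X_def sum.distrib)
  then have "real L * (2 * X) = (\<Sum>d\<in>?D. \<Sum>d'\<in>?D. real L * (pairing L k (d' - d) + pairing L k (- (d' - d))))"
    by (simp add: sum_distrib_left)
  also have "\<dots> \<le> (\<Sum>d\<in>?D. real L * (2 * pairing L k 0) + 4 * real L ^ k * 4)"
  proof (rule sum_mono)
    fix d assume d: "d \<in> ?D"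
    have "(\<Sum>d'\<in>?D. real L * (pairing L k (d' - d) + pairing L k (- (d' - d))))
      = real L * (2 * pairing L k 0) + (\<Sum>d'\<in>?D - {d}. real L * (pairing L k (d' - d) + pairing L k (- (d' - d))))"
      using d by (subst sum.remove[of _ d]) auto
    also have "(\<Sum>d'\<in>?D - {d}. real L * (pairing L k (d' - d) + pairing L k (- (d' - d))))
      \<le> (\<Sum>d'\<in>?D - {d}. 4 * real L ^ k / (of_int (d' - d))\<^sup>2)"
      by (intro sum_mono pairing_pair) auto
    also have "\<dots> = 4 * real L ^ k * (\<Sum>d'\<in>?D - {d}. 1 / (of_int (d' - d))\<^sup>2)"
      by (simp add: sum_distrib_left)
    also have "\<dots> \<le> 4 * real L ^ k * 4"
      by (intro mult_left_mono sum_inverse_squares_neighbours) auto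
    finally show "(\<Sum>d'\<in>?D. real L * (pairing L k (d' - d) + pairing L k (- (d' - d)))) \<le> real L * (2 * pairing L k 0) + 4 * real L ^ k * 4" by simp
  qed
  also have "\<dots> = real L * (2 * (real L * pairing L k 0 + 8 * real L ^ k))" by (simp add: algebra_simps)
  finally have "X \<le> real L * pairing L k 0 + 8 * real L ^ k" using L by simp
  then show ?thesis using split Jle by simp
qed

lemma pairing_bound: "real L * pairing L k 0 \<le> - (real k * real L ^ k * (gain L - 8))"
proof (induction k)
  case 0
  have "edge_cells L 0 = {}" by (auto simp: edge_cells_def)
  then show ?case by (simp add: pairing_def)
next
  case (Suc k)
  have "real L * pairing L (Suc k) 0 \<le> real L * (real L * pairing L k 0 + 8 * real L ^ k - real L ^ k * gain L)"
    by (intro mult_left_mono pairing_Suc) simp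
  also have "\<dots> = real L * (real L * pairing L k 0) - real L * (real L ^ k * (gain L - 8))" by (simp add: algebra_simps)
  also have "\<dots> \<le> real L * (- (real k * real L ^ k * (gain L - 8))) - real L * (real L ^ k * (gain L - 8))"
    by (intro diff_right_mono mult_left_mono Suc) simp
  also have "\<dots> = - (real (Suc k) * real L ^ Suc k * (gain L - 8))" by (simp add: algebra_simps)
  finally show ?case .
qed

lemma pairing_top: "pairing L L 0 \<le> - (real L ^ L * (gain L - 8))"
proof -
  have "real L * pairing L L 0 \<le> real L * - (real L ^ L * (gain L - 8))" using pairing_bound[of L] by simp
  then show ?thesis using L by (simp only: mult_le_cancel_left_pos)
qed

end

lemma gain_eq_harm: "gain L = harm (L + 2) - 3 / 2"
proof (induction L)
  case 0
  show ?case by (simp add: gain_def harm_def numeral_2_eq_2)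
next
  case (Suc L)
  have "{2..int (Suc L) + 1} = insert (int L + 2) {2..int L + 1}" by auto
  then have "gain (Suc L) = 1 / (real L + 3) + gain L" by (simp add: gain_def)
  then show ?case using Suc by (simp add: harm_Suc inverse_eq_divide)
qed

lemma gain_unbounded: "\<exists>L\<ge>4. K \<le> gain L"
proof -
  have "\<forall>\<^sub>F n in sequentially. K + 3 / 2 \<le> (harm n :: real)"
    using harm_at_top by (simp add: filterlim_at_top)
  then obtain n where "\<forall>m\<ge>n. K + 3 / 2 \<le> (harm m :: real)" unfolding eventually_sequentially by blast
  then have "K + 3 / 2 \<le> harm (max n 4 + 2)" by auto
  then show ?thesis unfolding gain_eq_harm by (intro exI[of _ "max n 4"]) auto
qed

section \<open>Averages of the pattern\<close>
lemma nn_integral_cells: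
  fixes \<phi> :: "int \<Rightarrow> real"
  assumes "finite A"
  shows "(\<integral>\<^sup>+y. ennreal (\<phi> \<lfloor>y\<rfloor>) * indicator {y. \<lfloor>y\<rfloor> \<in> A} (y::real) \<partial>lborel) = (\<Sum>c\<in>A. ennreal (\<phi> c))"
proof -
  have "(\<integral>\<^sup>+y. ennreal (\<phi> \<lfloor>y\<rfloor>) * indicator {y. \<lfloor>y\<rfloor> \<in> A} (y::real) \<partial>lborel)
     = (\<integral>\<^sup>+y. (\<Sum>c\<in>A. ennreal (\<phi> c) * indicator {of_int c..<of_int c + 1} (y::real)) \<partial>lborel)"
  proof (rule nn_integral_cong)
    fix y :: real
    have "(\<Sum>c\<in>A. ennreal (\<phi> c) * indicator {of_int c..<of_int c + 1} (y::real)) = (\<Sum>c\<in>A. if c = \<lfloor>y\<rfloor> then ennreal (\<phi> c) else 0)"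
      by (intro sum.cong refl) (auto simp: indicator_def floor_eq_iff, linarith+)
    also have "\<dots> = ennreal (\<phi> \<lfloor>y\<rfloor>) * indicator {y. \<lfloor>y\<rfloor> \<in> A} y"
      using assms by (simp add: sum.delta indicator_def)
    finally show "ennreal (\<phi> \<lfloor>y\<rfloor>) * indicator {y. \<lfloor>y\<rfloor> \<in> A} y = (\<Sum>c\<in>A. ennreal (\<phi> c) * indicator {of_int c..<of_int c + 1} (y::real))" ..
  qed
  also have "\<dots> = (\<Sum>c\<in>A. \<integral>\<^sup>+y. ennreal (\<phi> c) * indicator {of_int c..<of_int c + 1} (y::real) \<partial>lborel)"
    by (rule nn_integral_sum) measurable
  also have "\<dots> = (\<Sum>c\<in>A. ennreal (\<phi> c))"
    by (intro sum.cong refl) (simp add: nn_integral_cmult)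
  finally show ?thesis .
qed

lemma sum_grid_le:
  fixes f :: "int \<Rightarrow> real"
  assumes "a \<le> b" and S: "0 < S" and le: "\<And>i. (\<Sum>c\<in>{i * S..<(i + 1) * S}. f c) \<le> M"
  shows "(\<Sum>c\<in>{a * S..<b * S}. f c) \<le> of_int (b - a) * M"
  using assms(1)
proof (induction b rule: int_ge_induct)
  case (step b)
  have "a * S \<le> b * S" "b * S \<le> (b + 1) * S" using step S by (auto intro: mult_right_mono)
  then have "(\<Sum>c\<in>{a * S..<(b + 1) * S}. f c) = (\<Sum>c\<in>{a * S..<b * S}. f c) + (\<Sum>c\<in>{b * S..<(b + 1) * S}. f c)"
    using ivl_disj_un_two(3)[of "a * S" "b * S" "(b + 1) * S"] by (subst sum.union_disjoint[symmetric]) auto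
  then show ?case using step le[of b] by (simp add: algebra_simps)
qed simp

text \<open>
  Let x lie on a plateau of length (2L)^j. A shorter interval around x meets no greater density. A
  longer one of length d meets at most 3 d / (2L)^j grid cells of that length, each of mass at most
  2 L^j, and L^j / (2L)^j = 2^-j is twice the density at x. This accounts for the constant 12. The
  shift o' allows the pattern to be placed anywhere.
\<close>
lemma cell_weight_average:
  assumes L: "4 \<le> L" and k: "k \<le> 2 * L" and ne: "cell_weight L k (\<lfloor>x\<rfloor> - o') \<noteq> 0" and st: "s < x" "x < t"
  shows "(\<integral>\<^sup>+y\<in>{s<..<t}. ennreal (cell_weight L k (\<lfloor>y\<rfloor> - o')) \<partial>lborel) \<le> ennreal ((t - s) * (12 * cell_weight L k (\<lfloor>x\<rfloor> - o')))"
proof -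
  let ?w = "cell_weight L k (\<lfloor>x\<rfloor> - o')"
  have w0: "0 \<le> ?w" by (rule cell_weight_nonneg)
  have ptw: ?thesis if "\<And>y. y \<in> {s<..<t} \<Longrightarrow> cell_weight L k (\<lfloor>y\<rfloor> - o') \<le> ?w"
  proof -
    have "(\<integral>\<^sup>+y\<in>{s<..<t}. ennreal (cell_weight L k (\<lfloor>y\<rfloor> - o')) \<partial>lborel) \<le> (\<integral>\<^sup>+y. ennreal ?w * indicator {s<..<t} y \<partial>lborel)"
      using that by (intro nn_integral_mono) (auto simp: indicator_def intro!: ennreal_leI)
    also have "\<dots> = ennreal ((t - s) * ?w)"
    proof -
      have "(\<integral>\<^sup>+y. ennreal ?w * indicator {s<..<t} y \<partial>lborel) = ennreal ?w * ennreal (t - s)"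
        using st by (simp add: nn_integral_cmult)
      then show ?thesis using st w0 by (simp add: ennreal_mult[symmetric] mult.commute)
    qed
    also have "\<dots> \<le> ennreal ((t - s) * (12 * ?w))" using st w0 by (intro ennreal_leI mult_left_mono) auto
    finally show ?thesis .
  qed
  from cell_weight_values[OF ne] show ?thesis
  proof
    assume "?w = 1"
    then show ?thesis using ptw cell_weight_le_1 by simp
  next
    assume "\<exists>j<k. ?w = (1/2) ^ Suc j"
    then obtain j where j: "j < k" "?w = (1/2) ^ Suc j" by blast
    let ?S = "side L j"
    have S: "0 < ?S" by (rule side_pos[OF L])
    show ?thesis
    proof (cases "t - s \<le> of_int ?S")
      case True
      have "cell_weight L k (\<lfloor>y\<rfloor> - o') \<le> ?w" if y: "y \<in> {s<..<t}" for y
      proof (rule cell_weight_nearby[OF L j(2)])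
        have "\<bar>y - x\<bar> < of_int ?S" using y st True by auto
        then have "\<bar>\<lfloor>y\<rfloor> - \<lfloor>x\<rfloor>\<bar> \<le> ?S" by linarith
        then show "\<bar>\<lfloor>y\<rfloor> - o' - (\<lfloor>x\<rfloor> - o')\<bar> \<le> ?S" by simp
      qed
      then show ?thesis by (rule ptw)
    next
      case False
      define a where "a = (\<lfloor>s\<rfloor> - o') div ?S"
      define b where "b = (\<lfloor>t\<rfloor> - o') div ?S + 1"
      have ra: "a * ?S \<le> \<lfloor>s\<rfloor> - o'" "\<lfloor>s\<rfloor> - o' < a * ?S + ?S"
        using S div_mult_mod_eq[of "\<lfloor>s\<rfloor> - o'" ?S] pos_mod_bound[OF S, of "\<lfloor>s\<rfloor> - o'"] pos_mod_sign[OF S, of "\<lfloor>s\<rfloor> - o'"]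
        unfolding a_def by linarith+
      have rb: "b * ?S - ?S \<le> \<lfloor>t\<rfloor> - o'" "\<lfloor>t\<rfloor> - o' < b * ?S"
        using S div_mult_mod_eq[of "\<lfloor>t\<rfloor> - o'" ?S] pos_mod_bound[OF S, of "\<lfloor>t\<rfloor> - o'"] pos_mod_sign[OF S, of "\<lfloor>t\<rfloor> - o'"]
        unfolding b_def distrib_right by linarith+
      have fl: "\<lfloor>s\<rfloor> \<le> \<lfloor>t\<rfloor>" using st by linarith
      have "a * ?S < b * ?S" using ra rb fl by linarith
      then have ab: "a \<le> b" using S by (simp add: mult_less_cancel_right)
      define A where "A = (\<lambda>c. c + o') ` {a * ?S..<b * ?S}"
      have "(\<integral>\<^sup>+y\<in>{s<..<t}. ennreal (cell_weight L k (\<lfloor>y\<rfloor> - o')) \<partial>lborel)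
         \<le> (\<integral>\<^sup>+y. ennreal (cell_weight L k (\<lfloor>y\<rfloor> - o')) * indicator {y. \<lfloor>y\<rfloor> \<in> A} (y::real) \<partial>lborel)"
      proof (intro nn_integral_mono mult_left_mono)
        fix y
        have "\<lfloor>y\<rfloor> \<in> A" if "y \<in> {s<..<t}"
        proof -
          have "\<lfloor>s\<rfloor> \<le> \<lfloor>y\<rfloor>" "\<lfloor>y\<rfloor> \<le> \<lfloor>t\<rfloor>" using that by (auto intro: floor_mono)
          then have "\<lfloor>y\<rfloor> - o' \<in> {a * ?S..<b * ?S}" using ra rb by auto
          then show ?thesis unfolding A_def by (intro image_eqI[of _ _ "\<lfloor>y\<rfloor> - o'"]) auto
        qed
        then show "indicator {s<..<t} y \<le> (indicator {y. \<lfloor>y\<rfloor> \<in> A} y :: ennreal)" by (auto simp: indicator_def)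
      qed simp
      also have "\<dots> = (\<Sum>c\<in>A. ennreal (cell_weight L k (c - o')))"
        by (rule nn_integral_cells[of A "\<lambda>c. cell_weight L k (c - o')"]) (simp add: A_def)
      also have "\<dots> = ennreal (\<Sum>c\<in>{a * ?S..<b * ?S}. cell_weight L k c)"
        unfolding A_def by (subst sum.reindex) (auto simp: inj_on_def cell_weight_nonneg)
      also have "\<dots> \<le> ennreal (of_int (b - a) * (2 * real L ^ j))"
        using j k by (intro ennreal_leI sum_grid_le ab S cell_weight_grid_mass[OF L]) auto
      also have "\<dots> \<le> ennreal ((t - s) * (12 * ?w))"
      proof (rule ennreal_leI)
        have "b * ?S - ?S - (a * ?S + ?S) < \<lfloor>t\<rfloor> - \<lfloor>s\<rfloor>" using ra rb by linarith
        then have "b * ?S - a * ?S - 2 * ?S \<le> \<lfloor>t\<rfloor> - \<lfloor>s\<rfloor> - 1" by linarith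
        then have "real_of_int (b * ?S - a * ?S - 2 * ?S) \<le> real_of_int (\<lfloor>t\<rfloor> - \<lfloor>s\<rfloor> - 1)" by (rule of_int_le_iff[THEN iffD2])
        also have "\<dots> \<le> t - s" by linarith
        finally have "of_int (b - a) * real_of_int ?S \<le> 3 * (t - s)" using False by (simp add: algebra_simps)
        then have "of_int (b - a) * real_of_int ?S * (4 * ?w) \<le> 3 * (t - s) * (4 * ?w)"
          using w0 by (intro mult_right_mono) auto
        moreover have "real_of_int ?S * (4 * ?w) = 2 * real L ^ j"
          unfolding j(2) by (simp add: side_def power_mult_distrib power_one_over)
        ultimately have "of_int (b - a) * (2 * real L ^ j) \<le> 3 * (t - s) * (4 * ?w)" by (metis mult.assoc)
        moreover have "3 * (t - s) * (4 * ?w) = (t - s) * (12 * ?w)" by (simp add: algebra_simps)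
        ultimately show "of_int (b - a) * (2 * real L ^ j) \<le> (t - s) * (12 * ?w)" by (simp only:)
      qed
      finally show ?thesis .
    qed
  qed
qed

section \<open>Gluing the patterns together\<close>
definition block_start :: "nat \<Rightarrow> int" where "block_start L = 4 ^ L * side L L"

text \<open>
  The factor 2^L lifts the smallest density of the L-th pattern to 1 and keeps its mass comparable
  with its length. Then the averages over long intervals, which see other patterns too, remain
  bounded.
\<close>
definition block_weight :: "nat \<Rightarrow> int \<Rightarrow> real" where
  "block_weight L c = 2 ^ L * cell_weight L L (c - block_start L)"

text \<open>
  A pattern starts at or after the coordinate given by its number (block_start_ge_index), so this
  finite sum contains every pattern that can meet the cell.
\<close>
definition glued_cell :: "int \<Rightarrow> real" where "glued_cell c = (\<Sum>L\<in>{4..nat c}. block_weight L c)"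

definition glued :: "real \<Rightarrow> real" where "glued x = glued_cell \<lfloor>x\<rfloor>"

lemma block_weight_nonneg: "0 \<le> block_weight L c" by (simp add: block_weight_def cell_weight_nonneg)
lemma glued_cell_nonneg: "0 \<le> glued_cell c" unfolding glued_cell_def by (intro sum_nonneg block_weight_nonneg)
lemma glued_nonneg: "0 \<le> glued x" by (simp add: glued_def glued_cell_nonneg)

lemma block_start_ge: "4 \<le> L \<Longrightarrow> 4 * side L L \<le> block_start L"
proof -
  assume L: "4 \<le> L"
  have "(4::int) ^ 1 \<le> 4 ^ L" using L by (intro power_increasing) auto
  then have "4 * side L L \<le> 4 ^ L * side L L" using side_pos[OF L, of L] by (intro mult_right_mono) auto
  then show ?thesis by (simp add: block_start_def)
qed

lemma block_start_Suc: "4 \<le> L \<Longrightarrow> 4 * block_start L \<le> block_start (Suc L)"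
proof -
  assume L: "4 \<le> L"
  have "side L L \<le> side (Suc L) (Suc L)"
  proof -
    have "side L L \<le> (2 * int (Suc L)) ^ L" unfolding side_def by (intro power_mono) auto
    also have "\<dots> \<le> side (Suc L) (Suc L)" unfolding side_def by (intro power_increasing) auto
    finally show ?thesis .
  qed
  then have "4 ^ Suc L * side L L \<le> 4 ^ Suc L * side (Suc L) (Suc L)" by (intro mult_left_mono) auto
  then show ?thesis by (simp add: block_start_def)
qed

lemma block_start_pos: "4 \<le> L \<Longrightarrow> 0 < block_start L"
  using block_start_ge[of L] side_pos[of L L] by linarith

lemma block_start_mono: "4 \<le> L \<Longrightarrow> L < M \<Longrightarrow> 4 * block_start L \<le> block_start M"
proof (induction M)
  case (Suc M)
  show ?case
  proof (cases "L = M")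
    case False
    then have "4 * block_start L \<le> block_start M" using Suc by simp
    then show ?thesis using block_start_Suc[of M] block_start_pos[of M] Suc.prems by linarith
  qed (use Suc block_start_Suc in auto)
qed simp

lemma block_start_ge_index: "4 \<le> L \<Longrightarrow> int L \<le> block_start L"
proof -
  assume L: "4 \<le> L"
  have "(2 * int L) ^ 1 \<le> side L L" unfolding side_def using L by (intro power_increasing) auto
  then show ?thesis using block_start_ge[OF L] L by simp
qed

lemma block_weight_support:
  assumes "4 \<le> L" "block_weight L c \<noteq> 0"
  shows "block_start L \<le> c" "c < block_start L + side L L" "4 * c < 5 * block_start L" "L \<le> nat c"
proof -
  have "cell_weight L L (c - block_start L) \<noteq> 0" using assms by (simp add: block_weight_def)
  from cell_weight_support[OF assms(1) this] show *: "block_start L \<le> c" "c < block_start L + side L L" by auto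
  then show "4 * c < 5 * block_start L" "L \<le> nat c" using block_start_ge[OF assms(1)] block_start_ge_index[OF assms(1)] by auto
qed

text \<open>
  The starting points grow by a factor of at least 4 while a pattern occupies at most a quarter of
  its starting coordinate, so no other pattern meets the range between half and twice the start.
\<close>
lemma glued_cell_eq_block:
  assumes L: "4 \<le> L" and c: "block_start L \<le> 2 * c" "c < 2 * block_start L"
  shows "glued_cell c = block_weight L c"
proof -
  have z: "block_weight M c = 0" if "4 \<le> M" "M \<noteq> L" for M
  proof (rule ccontr)
    assume "block_weight M c \<noteq> 0"
    note s = block_weight_support[OF that(1) this]
    show False
    proof (cases "M < L")
      case True
      then show ?thesis using block_start_mono[OF that(1) True] s c block_start_pos[OF L] by linarith
    next
      case False
      then show ?thesis using block_start_mono[OF L, of M] that s c block_start_pos[OF L] by linarith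
    qed
  qed
  show ?thesis
  proof (cases "block_weight L c = 0")
    case True
    then have "glued_cell c = 0" unfolding glued_cell_def using z by (intro sum.neutral) (metis atLeastAtMost_iff)
    then show ?thesis using True by simp
  next
    case False
    then have "L \<in> {4..nat c}" using block_weight_support[OF L] L by simp
    then have "glued_cell c = block_weight L c + (\<Sum>M\<in>{4..nat c} - {L}. block_weight M c)" unfolding glued_cell_def by (subst sum.remove) auto
    also have "(\<Sum>M\<in>{4..nat c} - {L}. block_weight M c) = 0" using z by (intro sum.neutral) auto
    finally show ?thesis by simp
  qed
qed

lemma glued_cell_pos_cases:
  assumes "glued_cell c \<noteq> 0"
  obtains L where "4 \<le> L" "block_weight L c \<noteq> 0" "glued_cell c = block_weight L c"
proof -
  obtain L where L: "L \<in> {4..nat c}" "block_weight L c \<noteq> 0" using assms unfolding glued_cell_def by (meson sum.neutral)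
  then have "glued_cell c = block_weight L c" using block_weight_support[of L c] by (intro glued_cell_eq_block) auto
  then show ?thesis using that L by auto
qed

text \<open>
  The subtracted term is what the induction needs; only the bound 1/2 is of interest.
\<close>
lemma sum_quarter_powers_le: "(\<Sum>L\<in>{4..<4 + n}. (1/4::real) ^ L) \<le> 1/2 - 2 * (1/4) ^ (4 + n)"
proof (induction n)
  case (Suc n)
  have "(\<Sum>L\<in>{4..<4 + Suc n}. (1/4::real) ^ L) = (\<Sum>L\<in>{4..<4 + n}. (1/4::real) ^ L) + (1/4) ^ (4 + n)"
    by (subst add_Suc_right, subst sum.atLeastLessThan_Suc) simp_all
  moreover have "(1/4::real) ^ (4 + Suc n) = (1/4) ^ (4 + n) / 4" "0 \<le> (1/4::real) ^ (4 + n)"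
    by (simp_all only: add_Suc_right power_Suc) simp_all
  ultimately show ?case using Suc by linarith
qed (simp add: power4_eq_xxxx)

lemma block_weight_mass: 
  assumes L: "4 \<le> L"
  shows "(\<Sum>c\<in>{0..<T}. block_weight L c) \<le> 2 * of_int (side L L)"
proof -
  have "(\<Sum>c\<in>{0..<T}. block_weight L c) \<le> (\<Sum>c\<in>{0..<T} \<union> {block_start L + 0..<block_start L + side L L}. block_weight L c)"
    by (intro sum_mono2) (auto simp: block_weight_nonneg)
  also have "\<dots> = (\<Sum>c\<in>{block_start L + 0..<block_start L + side L L}. block_weight L c)"
  proof (intro sum.mono_neutral_right ballI)
    fix c assume c: "c \<in> {0..<T} \<union> {block_start L + 0..<block_start L + side L L} - {block_start L + 0..<block_start L + side L L}"
    show "block_weight L c = 0"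
    proof (rule ccontr)
      assume "block_weight L c \<noteq> 0"
      then have "block_start L \<le> c" "c < block_start L + side L L" using block_weight_support[OF L] by blast+
      then show False using c by simp
    qed
  qed auto
  also have "\<dots> = 2 ^ L * (\<Sum>c\<in>{0..<side L L}. cell_weight L L c)"
    unfolding sum_shift_int by (simp add: block_weight_def sum_distrib_left)
  also have "\<dots> = 2 ^ L * (real L ^ L * (3 / 2))" using L by (simp add: cell_weight_mass[OF L])
  also have "\<dots> \<le> 2 * of_int (side L L)" by (simp add: side_def power_mult_distrib)
  finally show ?thesis .
qed

text \<open>
  A pattern that begins before T has mass at most twice its length, hence at most 2 T / 4^L; these
  bounds sum to at most T.
\<close>
lemma glued_cell_mass:
  assumes "0 \<le> T"
  shows "(\<Sum>c\<in>{0..<T}. glued_cell c) \<le> of_int T"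
proof -
  have "(\<Sum>c\<in>{0..<T}. glued_cell c) \<le> (\<Sum>c\<in>{0..<T}. \<Sum>L\<in>{4..<4 + nat T}. block_weight L c)"
    unfolding glued_cell_def by (intro sum_mono sum_mono2) (auto simp: block_weight_nonneg)
  also have "\<dots> = (\<Sum>L\<in>{4..<4 + nat T}. \<Sum>c\<in>{0..<T}. block_weight L c)" by (rule sum.swap)
  also have "\<dots> \<le> (\<Sum>L\<in>{4..<4 + nat T}. 2 * of_int T * (1/4) ^ L)"
  proof (rule sum_mono)
    fix L assume "L \<in> {4..<4 + nat T}"
    then have L: "4 \<le> L" by simp
    show "(\<Sum>c\<in>{0..<T}. block_weight L c) \<le> 2 * of_int T * (1/4) ^ L"
    proof (cases "block_start L < T")
      case True
      have "real_of_int (side L L) = of_int (block_start L) * (1/4) ^ L" by (simp add: block_start_def power_one_over)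
      also have "\<dots> \<le> of_int T * (1/4) ^ L" using True by (intro mult_right_mono) auto
      finally show ?thesis using block_weight_mass[OF L, of T] by simp
    next
      case False
      then have "(\<Sum>c\<in>{0..<T}. block_weight L c) = 0" using block_weight_support[OF L] by (intro sum.neutral) force
      then show ?thesis using assms by simp
    qed
  qed
  also have "\<dots> = 2 * of_int T * (\<Sum>L\<in>{4..<4 + nat T}. (1/4) ^ L)" by (simp add: sum_distrib_left)
  also have "\<dots> \<le> 2 * of_int T * (1/2)"
  proof (intro mult_left_mono)
    have "0 \<le> 2 * (1/4::real) ^ (4 + nat T)" by simp
    then show "(\<Sum>L\<in>{4..<4 + nat T}. (1/4::real) ^ L) \<le> 1/2" using sum_quarter_powers_le[of "nat T"] by linarith
  qed (use assms in simp)
  finally show ?thesis by simp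
qed

lemma glued_measurable [measurable]: "glued \<in> borel_measurable borel"
  unfolding glued_def[abs_def] by measurable

lemma glued_cell_negative: "c < 0 \<Longrightarrow> glued_cell c = 0" by (simp add: glued_cell_def)

lemma glued_mass:
  "(\<integral>\<^sup>+y\<in>{s<..<t}. ennreal (glued y) \<partial>lborel) \<le> ennreal (of_int (max 0 (\<lfloor>t\<rfloor> + 1)))"
proof -
  let ?T = "max 0 (\<lfloor>t\<rfloor> + 1)"
  have "(\<integral>\<^sup>+y\<in>{s<..<t}. ennreal (glued y) \<partial>lborel) \<le> (\<integral>\<^sup>+y. ennreal (glued_cell \<lfloor>y\<rfloor>) * indicator {y. \<lfloor>y\<rfloor> \<in> {0..<?T}} (y::real) \<partial>lborel)"
  proof (rule nn_integral_mono)
    fix y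
    show "ennreal (glued y) * indicator {s<..<t} y \<le> ennreal (glued_cell \<lfloor>y\<rfloor>) * indicator {y. \<lfloor>y\<rfloor> \<in> {0..<?T}} y"
    proof (cases "\<lfloor>y\<rfloor> < 0")
      case True
      then show ?thesis by (simp add: glued_def glued_cell_negative)
    next
      case False
      have "y < t \<Longrightarrow> \<lfloor>y\<rfloor> < \<lfloor>t\<rfloor> + 1" by linarith
      then show ?thesis using False by (auto simp: indicator_def glued_def)
    qed
  qed
  also have "\<dots> = ennreal (\<Sum>c\<in>{0..<?T}. glued_cell c)"
    by (subst nn_integral_cells) (auto simp: glued_cell_nonneg)
  also have "\<dots> \<le> ennreal (of_int ?T)" by (intro ennreal_leI glued_cell_mass) simp
  finally show ?thesis .
qed

lemma glued_ge_1: "glued x \<noteq> 0 \<Longrightarrow> 1 \<le> glued x"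
proof -
  assume "glued x \<noteq> 0"
  then obtain L where L: "4 \<le> L" "block_weight L \<lfloor>x\<rfloor> \<noteq> 0" "glued_cell \<lfloor>x\<rfloor> = block_weight L \<lfloor>x\<rfloor>"
    unfolding glued_def by (rule glued_cell_pos_cases)
  have "(1/2::real) ^ L \<le> cell_weight L L (\<lfloor>x\<rfloor> - block_start L)" using L by (intro cell_weight_ge_half_power) (auto simp: block_weight_def)
  then have "2 ^ L * (1/2::real) ^ L \<le> block_weight L \<lfloor>x\<rfloor>" unfolding block_weight_def by (intro mult_left_mono) auto
  then show ?thesis using L by (simp add: glued_def power_one_over)
qed

text \<open>
  An interval shorter than a quarter of the starting coordinate sees a single pattern. For a longer
  one the total mass to the left of its right end is at most a multiple of its length, while the
  weight is at least 1 at x.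
\<close>
lemma glued_average:
  assumes ne: "glued x \<noteq> 0" and st: "s < x" "x < t"
  shows "(\<integral>\<^sup>+y\<in>{s<..<t}. ennreal (glued y) \<partial>lborel) \<le> ennreal ((t - s) * (13 * glued x))"
proof -
  obtain L where L: "4 \<le> L" "block_weight L \<lfloor>x\<rfloor> \<noteq> 0" "glued_cell \<lfloor>x\<rfloor> = block_weight L \<lfloor>x\<rfloor>"
    using ne unfolding glued_def by (rule glued_cell_pos_cases)
  note sup = block_weight_support[OF L(1,2)]
  define R where "R = real_of_int (block_start L)"
  \<comment> \<open>R is large enough for the rounding to unit cells to cost at most R / 4.\<close>
  have R: "256 \<le> R"
  proof -
    have "(4::int) ^ 4 \<le> 4 ^ L" using L by (intro power_increasing) auto
    also have "\<dots> \<le> 4 ^ L * side L L" using side_pos[OF L(1), of L] by simp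
    finally have "256 \<le> block_start L" by (simp add: block_start_def)
    then show ?thesis unfolding R_def by linarith
  qed
  have xR: "R \<le> x" "x < 5/4 * R + 1"
  proof -
    have "R \<le> of_int \<lfloor>x\<rfloor>" using sup(1) by (simp add: R_def)
    then show "R \<le> x" by linarith
    have "real_of_int (4 * \<lfloor>x\<rfloor>) < real_of_int (5 * block_start L)" using sup(3) by (rule of_int_less_iff[THEN iffD2])
    then show "x < 5/4 * R + 1" unfolding R_def by simp linarith
  qed
  show ?thesis
  proof (cases "t - s < R / 4")
    case True
    have eq: "glued y = 2 ^ L * cell_weight L L (\<lfloor>y\<rfloor> - block_start L)" if y: "y \<in> {s<..<t}" for y
    proof -
      have "R / 2 \<le> of_int \<lfloor>y\<rfloor>" "of_int \<lfloor>y\<rfloor> < 2 * R" using y st True xR R by (auto, linarith+)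
      then have "block_start L \<le> 2 * \<lfloor>y\<rfloor>" "\<lfloor>y\<rfloor> < 2 * block_start L" unfolding R_def by linarith+
      then show ?thesis unfolding glued_def by (simp add: glued_cell_eq_block[OF L(1)] block_weight_def)
    qed
    have wne: "cell_weight L L (\<lfloor>x\<rfloor> - block_start L) \<noteq> 0" using L by (simp add: block_weight_def)
    have "(\<integral>\<^sup>+y\<in>{s<..<t}. ennreal (glued y) \<partial>lborel) = (\<integral>\<^sup>+y. ennreal (2 ^ L) * (ennreal (cell_weight L L (\<lfloor>y\<rfloor> - block_start L)) * indicator {s<..<t} y) \<partial>lborel)"
      using eq by (intro nn_integral_cong) (auto simp: indicator_def ennreal_mult cell_weight_nonneg)
    also have "\<dots> = ennreal (2 ^ L) * (\<integral>\<^sup>+y\<in>{s<..<t}. ennreal (cell_weight L L (\<lfloor>y\<rfloor> - block_start L)) \<partial>lborel)"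
      by (rule nn_integral_cmult) measurable
    also have "\<dots> \<le> ennreal (2 ^ L) * ennreal ((t - s) * (12 * cell_weight L L (\<lfloor>x\<rfloor> - block_start L)))"
      using L st wne by (intro mult_left_mono cell_weight_average) auto
    also have "\<dots> = ennreal ((t - s) * (12 * glued x))"
      using eq[of x] st by (simp add: ennreal_mult'[symmetric] algebra_simps)
    also have "\<dots> \<le> ennreal ((t - s) * (13 * glued x))"
      using st glued_nonneg[of x] by (intro ennreal_leI mult_left_mono) auto
    finally show ?thesis .
  next
    case False
    have "0 \<le> \<lfloor>t\<rfloor>" using st xR R by linarith
    then have "real_of_int (max 0 (\<lfloor>t\<rfloor> + 1)) \<le> t + 1" by simp
    also have "\<dots> \<le> 13 * (t - s)" using False st xR R by argo
    also have "\<dots> = (t - s) * 13" by simp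
    also have "\<dots> \<le> (t - s) * (13 * glued x)" using glued_ge_1[OF ne] st by (intro mult_left_mono) auto
    finally have "ennreal (of_int (max 0 (\<lfloor>t\<rfloor> + 1))) \<le> ennreal ((t - s) * (13 * glued x))" by (rule ennreal_leI)
    then show ?thesis using glued_mass[of s t] by (rule order_trans[rotated])
  qed
qed

lemma maximal_glued_le: "0 < glued x \<Longrightarrow> maximal glued x \<le> ennreal (13 * glued x)"
proof (rule maximal_le)
  fix s t assume "0 < glued x" and st: "s < x" "x < t"
  then have "(\<integral>\<^sup>+y\<in>{s<..<t}. ennreal (glued y) \<partial>lborel) \<le> ennreal ((t - s) * (13 * glued x))"
    by (intro glued_average) auto
  then show "(\<integral>\<^sup>+y\<in>{s<..<t}. ennreal \<bar>glued y\<bar> \<partial>lborel) \<le> ennreal (t - s) * ennreal (13 * glued x)"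
    using st glued_nonneg by (simp add: ennreal_mult[symmetric])
qed

text \<open>
  The weight is constant on the rest of the unit cell to the right of x, which is an interval with
  endpoint x. The inequality thus holds at every point, not only almost everywhere.
\<close>
lemma maximal_glued_ge: "ennreal (glued x) \<le> maximal glued x"
proof -
  define d where "d = of_int \<lfloor>x\<rfloor> + 1 - x"
  have d: "0 < d" unfolding d_def by linarith
  let ?Q = "{x..<x + d}"
  have "(\<integral>\<^sup>+y\<in>?Q. ennreal \<bar>glued y\<bar> \<partial>lebesgue) = (\<integral>\<^sup>+y. ennreal (glued x) * indicator ?Q y \<partial>lborel)"
    unfolding nn_integral_completion
  proof (intro nn_integral_cong)
    fix y
    have "\<lfloor>y\<rfloor> = \<lfloor>x\<rfloor>" if "y \<in> ?Q" using that unfolding d_def floor_eq_iff by auto linarith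
    then show "ennreal \<bar>glued y\<bar> * indicator ?Q y = ennreal (glued x) * indicator ?Q y"
      by (auto simp: indicator_def glued_def glued_cell_nonneg)
  qed
  also have "\<dots> = ennreal (glued x) * ennreal d" using d by (simp add: nn_integral_cmult)
  finally have I: "(\<integral>\<^sup>+y\<in>?Q. ennreal \<bar>glued y\<bar> \<partial>lebesgue) = ennreal (glued x) * ennreal d" .
  have "indicator ?Q x / emeasure lebesgue ?Q * (\<integral>\<^sup>+y\<in>?Q. ennreal \<bar>glued y\<bar> \<partial>lebesgue) \<le> maximal glued x"
    unfolding maximal_def using d by (intro SUP_upper) (auto simp: is_interval_co)
  moreover have "indicator ?Q x / emeasure lebesgue ?Q * (ennreal (glued x) * ennreal d) = ennreal (glued x)"
  proof -
    have "emeasure lebesgue ?Q = ennreal d" using d by simp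
    moreover have "1 / ennreal d * (ennreal (glued x) * ennreal d) = ennreal (glued x)"
      using d glued_nonneg[of x] by (simp add: divide_ennreal ennreal_mult[symmetric] flip: ennreal_1)
    ultimately show ?thesis using d by simp
  qed
  ultimately show ?thesis unfolding I by simp
qed

section \<open>The Hilbert transform of a union of cells\<close>
definition step_indicator :: "int set \<Rightarrow> real \<Rightarrow> real" where
  "step_indicator A y = (if \<lfloor>y\<rfloor> \<in> A then 1 else 0)"

lemma step_indicator_measurable [measurable]: "step_indicator A \<in> borel_measurable borel"
  unfolding step_indicator_def[abs_def] by measurable

lemma step_indicator_eq_sum:
  assumes "finite A"
  shows "step_indicator A y = (\<Sum>e\<in>A. indicator {of_int e..<of_int e + 1} y)"
proof -
  have "(\<Sum>e\<in>A. indicator {of_int e..<of_int e + 1} y) = (\<Sum>e\<in>A. if e = \<lfloor>y\<rfloor> then 1 else (0::real))"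
    by (intro sum.cong refl) (auto simp: indicator_def floor_eq_iff, linarith+)
  then show ?thesis using assms by (simp add: step_indicator_def)
qed

text \<open>
  If x is at distance at least 1 from the cells, the truncated integrals are constant for small
  truncation. The principal value is then an absolutely convergent integral and can be estimated cell
  by cell, since z \<mapsto> 1/z is decreasing on either side of 0.
\<close>
lemma hilbert_step_le:
  assumes A: "finite A" and far: "\<And>e. e \<in> A \<Longrightarrow> 2 \<le> \<bar>e - \<lfloor>x\<rfloor>\<bar>"
  shows "hilbert (step_indicator A) x \<le> (\<Sum>e\<in>A. 1 / of_int (e - \<lfloor>x\<rfloor> - 1))"
proof -
  let ?f = "step_indicator A"
  define g where "g y = ?f y / (y - x)" for y
  have near: "?f y = 0" if "\<bar>y - x\<bar> < 1" for y
  proof -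
    have "\<bar>\<lfloor>y\<rfloor> - \<lfloor>x\<rfloor>\<bar> < 2" using that by linarith
    then show ?thesis using far by (force simp: step_indicator_def)
  qed
  have [measurable]: "g \<in> borel_measurable borel" unfolding g_def[abs_def] by measurable
  have int_ind: "integrable lborel (\<lambda>y::real. indicator {of_int e..<of_int e + 1} y * c :: real)" for e :: int and c :: real
    by (intro integrable_mult_left integrable_real_indicator) auto
  have f_int: "integrable lborel ?f"
  proof -
    have "?f = (\<lambda>y. \<Sum>e\<in>A. indicator {of_int e..<of_int e + 1} y * 1)"
      using step_indicator_eq_sum[OF A] by auto
    then show ?thesis using int_ind[where c = 1] by simp
  qed
  have g_int: "integrable lborel g"
  proof (rule Bochner_Integration.integrable_bound[OF f_int])
    show "AE y in lborel. norm (g y) \<le> norm (?f y)"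
    proof (intro AE_I2)
      fix y
      show "norm (g y) \<le> norm (?f y)"
      proof (cases "\<bar>y - x\<bar> < 1")
        case False
        then have "\<bar>?f y\<bar> / \<bar>y - x\<bar> \<le> \<bar>?f y\<bar> / 1" by (intro divide_left_mono) auto
        then show ?thesis by (simp add: g_def abs_divide)
      qed (simp add: g_def near)
    qed
  qed measurable
  have g_leb: "integrable lebesgue g" using g_int by (simp add: integrable_completion)
  have set_int: "set_integrable lebesgue {y. \<epsilon> < \<bar>y - x\<bar>} (\<lambda>y. ?f y / (y - x))" for \<epsilon>
  proof -
    have "{y. \<epsilon> < \<bar>y - x\<bar>} \<in> sets lebesgue"
    proof -
      have "open {y. \<epsilon> < \<bar>y - x\<bar>}" by (intro open_Collect_less continuous_intros)
      then show ?thesis by simp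
    qed
    from integrable_mult_indicator[OF this g_leb] show ?thesis
      unfolding set_integrable_def g_def .
  qed
  have trunc: "hilbert_trunc ?f x \<epsilon> = integral\<^sup>L lborel g" if "0 < \<epsilon>" "\<epsilon> < 1" for \<epsilon>
  proof -
    have "hilbert_trunc ?f x \<epsilon> = integral\<^sup>L lebesgue g"
      unfolding hilbert_trunc_def set_lebesgue_integral_def
      using that near by (intro Bochner_Integration.integral_cong refl) (auto simp: indicator_def g_def)
    then show ?thesis by (simp add: integral_completion)
  qed
  have lim: "(hilbert_trunc ?f x \<longlongrightarrow> integral\<^sup>L lborel g) (at_right 0)"
  proof (rule tendsto_eventually)
    show "\<forall>\<^sub>F \<epsilon> in at_right 0. hilbert_trunc ?f x \<epsilon> = integral\<^sup>L lborel g"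
      unfolding eventually_at_right_field using trunc by (intro exI[of _ 1]) auto
  qed
  have "hilbert_exists ?f x" unfolding hilbert_exists_def using set_int lim by blast
  then have "hilbert ?f x = integral\<^sup>L lborel g"
    unfolding hilbert_def using tendsto_Lim[OF _ lim] by simp
  also have "\<dots> \<le> (\<integral>y. (\<Sum>e\<in>A. indicator {of_int e..<of_int e + 1} (y::real) * (1 / of_int (e - \<lfloor>x\<rfloor> - 1))) \<partial>lborel)"
  proof (rule integral_mono[OF g_int])
    show "integrable lborel (\<lambda>y::real. \<Sum>e\<in>A. indicator {of_int e..<of_int e + 1} y * (1 / of_int (e - \<lfloor>x\<rfloor> - 1)) :: real)"
      by (intro Bochner_Integration.integrable_sum int_ind)
    fix y
    have "g y = (\<Sum>e\<in>A. indicator {of_int e..<of_int e + 1} y * (1 / (y - x)))"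
      unfolding g_def step_indicator_eq_sum[OF A] by (simp add: sum_divide_distrib)
    also have "\<dots> \<le> (\<Sum>e\<in>A. indicator {of_int e..<of_int e + 1} y * (1 / of_int (e - \<lfloor>x\<rfloor> - 1)))"
    proof (rule sum_mono)
      fix e assume e: "e \<in> A"
      show "indicator {of_int e..<of_int e + 1} y * (1 / (y - x)) \<le> indicator {of_int e..<of_int e + 1} y * (1 / real_of_int (e - \<lfloor>x\<rfloor> - 1))"
      proof (cases "y \<in> {of_int e..<of_int e + 1}")
        case True
        have le: "real_of_int (e - \<lfloor>x\<rfloor> - 1) \<le> y - x" using True by auto linarith
        have "1 / (y - x) \<le> 1 / real_of_int (e - \<lfloor>x\<rfloor> - 1)"
        proof (cases "0 \<le> e - \<lfloor>x\<rfloor>")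
          case True
          then have "1 \<le> e - \<lfloor>x\<rfloor> - 1" using far[OF e] by linarith
          then have "0 < real_of_int (e - \<lfloor>x\<rfloor> - 1)" by linarith
          then show ?thesis using le by (intro divide_left_mono) auto
        next
          case False
          then have "e - \<lfloor>x\<rfloor> \<le> - 2" using far[OF e] by linarith
          then have neg: "y - x < 0" using True by auto linarith
          show ?thesis using le_imp_inverse_le_neg[OF le neg] by (simp add: inverse_eq_divide)
        qed
        then show ?thesis using True by simp
      qed simp
    qed
    finally show "g y \<le> (\<Sum>e\<in>A. indicator {of_int e..<of_int e + 1} y * (1 / of_int (e - \<lfloor>x\<rfloor> - 1)))" .
  qed
  also have "\<dots> = (\<Sum>e\<in>A. \<integral>y. indicator {of_int e..<of_int e + 1} (y::real) * (1 / of_int (e - \<lfloor>x\<rfloor> - 1)) \<partial>lborel)"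
    by (rule Bochner_Integration.integral_sum) (rule int_ind)
  also have "\<dots> = (\<Sum>e\<in>A. 1 / of_int (e - \<lfloor>x\<rfloor> - 1))"
  proof (intro sum.cong refl)
    fix e
    have "measure lborel {real_of_int e..<of_int e + 1} = 1" by simp
    then show "(\<integral>y. indicator {of_int e..<of_int e + 1} (y::real) * (1 / of_int (e - \<lfloor>x\<rfloor> - 1)) \<partial>lborel) = 1 / real_of_int (e - \<lfloor>x\<rfloor> - 1)"
      by (subst integral_mult_left_zero) simp
  qed
  finally show ?thesis .
qed

section \<open>The example\<close>

text \<open>
  The weight v of the theorem for w = glued; the value under enn2real is finite by maximal_glued_le.
\<close>
definition majorant :: "real \<Rightarrow> real \<Rightarrow> real" where
  "majorant p x = (if 0 < glued x then enn2real (epowr (maximal glued x / ennreal (glued x)) p * ennreal (glued x)) else 0)"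

lemma majorant_eq:
  assumes p: "1 < p"
  shows "ennreal (majorant p x) = (if 0 < glued x then epowr (maximal glued x / ennreal (glued x)) p * ennreal (glued x) else 0)"
    and majorant_ge: "0 < glued x \<Longrightarrow> maximal glued x \<le> ennreal (majorant p x)"
    and majorant_le: "majorant p x \<le> 13 powr p * glued x"
    and majorant_pos_iff: "0 < majorant p x \<longleftrightarrow> 0 < glued x"
proof -
  have *: "ennreal (majorant p x) = epowr (maximal glued x / ennreal (glued x)) p * ennreal (glued x) \<and>
     maximal glued x \<le> ennreal (majorant p x) \<and> majorant p x \<le> 13 powr p * glued x \<and> 0 < majorant p x" if w: "0 < glued x"
  proof -
    have "maximal glued x \<noteq> top" using maximal_glued_le[OF w] by (auto simp: top_unique)
    then obtain m where m: "0 \<le> m" "maximal glued x = ennreal m" by (cases "maximal glued x") auto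
    have mle: "m \<le> 13 * glued x" using maximal_glued_le[OF w] m w by simp
    have mge: "glued x \<le> m" using maximal_glued_ge[of x] m w by simp
    have q: "maximal glued x / ennreal (glued x) = ennreal (m / glued x)" using m w by (simp add: divide_ennreal)
    have "epowr (maximal glued x / ennreal (glued x)) p * ennreal (glued x) = ennreal ((m / glued x) powr p * glued x)"
      unfolding q using m w by (simp add: epowr_ennreal ennreal_mult)
    then have maj: "majorant p x = (m / glued x) powr p * glued x" using w by (simp add: majorant_def)
    have r1: "1 \<le> m / glued x" using mge w by simp
    have "m / glued x = (m / glued x) powr 1" using r1 by (subst powr_one) auto
    also have "\<dots> \<le> (m / glued x) powr p" using r1 p by (intro powr_mono) auto
    finally have "m / glued x \<le> (m / glued x) powr p" .
    then have "m / glued x * glued x \<le> majorant p x" unfolding maj using w by (intro mult_right_mono) auto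
    then have "m \<le> majorant p x" using w by simp
    moreover have "(m / glued x) powr p \<le> 13 powr p" using mle w m p by (intro powr_mono2) (auto simp: field_simps)
    ultimately show ?thesis
      using w m mge maj \<open>epowr (maximal glued x / ennreal (glued x)) p * ennreal (glued x) = ennreal ((m / glued x) powr p * glued x)\<close>
      by (auto simp: mult_right_mono)
  qed
  show "ennreal (majorant p x) = (if 0 < glued x then epowr (maximal glued x / ennreal (glued x)) p * ennreal (glued x) else 0)"
    using * by (auto simp: majorant_def)
  show "0 < glued x \<Longrightarrow> maximal glued x \<le> ennreal (majorant p x)" using * by blast
  show "majorant p x \<le> 13 powr p * glued x" using * glued_nonneg[of x] by (cases "0 < glued x") (auto simp: majorant_def)
  show "0 < majorant p x \<longleftrightarrow> 0 < glued x" using * by (auto simp: majorant_def)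
qed

lemma majorant_nonneg: "0 \<le> majorant p x" by (simp add: majorant_def)

lemma majorant_measurable [measurable]: "majorant p \<in> borel_measurable borel"
  unfolding majorant_def[abs_def] by measurable

lemma glued_local_finite: "(\<integral>\<^sup>+y\<in>{s<..<t}. ennreal (glued y) \<partial>lborel) < \<infinity>"
  by (rule le_less_trans[OF glued_mass]) auto

lemma weight_of_bound:
  assumes [measurable]: "u \<in> borel_measurable borel" and u0: "\<And>x. 0 \<le> u x" and le: "\<And>x. u x \<le> C * glued x" and C: "0 \<le> C"
  shows "weight u"
  unfolding weight_def
proof (intro conjI allI impI u0)
  fix K :: "real set" assume "compact K"
  then obtain b where b: "\<And>x. x \<in> K \<Longrightarrow> norm x \<le> b" using compact_imp_bounded bounded_iff by metis
  have [measurable]: "K \<in> sets borel" using \<open>compact K\<close> by (simp add: borel_compact)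
  have "integrable lborel (\<lambda>x. indicator K x *\<^sub>R u x)"
  proof (rule integrableI_bounded)
    have "(\<integral>\<^sup>+x. ennreal (norm (indicator K x *\<^sub>R u x)) \<partial>lborel) \<le> (\<integral>\<^sup>+x. ennreal C * (ennreal (glued x) * indicator {- b - 1<..<b + 1} x) \<partial>lborel)"
    proof (rule nn_integral_mono)
      fix x
      show "ennreal (norm (indicator K x *\<^sub>R u x)) \<le> ennreal C * (ennreal (glued x) * indicator {- b - 1<..<b + 1} x)"
      proof (cases "x \<in> K")
        case True
        then have "x \<in> {- b - 1<..<b + 1}" using b[of x] by auto
        then show ?thesis using True le[of x] u0[of x] C glued_nonneg[of x]
          by (simp add: ennreal_mult[symmetric] ennreal_leI)
      qed simp
    qed
    also have "\<dots> = ennreal C * (\<integral>\<^sup>+y\<in>{- b - 1<..<b + 1}. ennreal (glued y) \<partial>lborel)"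
      by (rule nn_integral_cmult) measurable
    also have "\<dots> < \<infinity>" using glued_local_finite[of "- b - 1" "b + 1"] by (simp add: ennreal_mult_less_top)
    finally show "(\<integral>\<^sup>+x. ennreal (norm (indicator K x *\<^sub>R u x)) \<partial>lborel) < \<infinity>" .
  qed measurable
  then show "set_integrable lebesgue K u"
    unfolding set_integrable_def by (simp add: integrable_completion)
qed

lemma shifted_cell_sum:
  fixes \<phi> :: "int \<Rightarrow> real"
  shows "(\<Sum>c\<in>(\<lambda>c. c + o') ` A. \<phi> c) = (\<Sum>c\<in>A. \<phi> (c + o'))"
  by (subst sum.reindex) (auto simp: inj_on_def)

lemma glued_cell_on_block:
  assumes L: "4 \<le> L" and c: "0 \<le> c" "c < side L L"
  shows "glued_cell (c + block_start L) = 2 ^ L * cell_weight L L c"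
proof -
  have "glued_cell (c + block_start L) = block_weight L (c + block_start L)"
    using c block_start_ge[OF L] block_start_pos[OF L] by (intro glued_cell_eq_block[OF L]) simp_all
  then show ?thesis by (simp add: block_weight_def)
qed

definition edge_indicator :: "nat \<Rightarrow> real \<Rightarrow> real" where
  "edge_indicator L = step_indicator ((\<lambda>c. c + block_start L) ` edge_cells L L)"

lemma majorant_integral_edge_indicator:
  assumes L: "4 \<le> L" and p: "1 < p"
  shows "(\<integral>\<^sup>+x. epowr (ennreal \<bar>edge_indicator L x\<bar>) p * ennreal (majorant p x) \<partial>lborel) \<le> ennreal (13 powr p * (2 ^ L * (2 * real L ^ L)))"
proof -
  let ?A = "(\<lambda>c. c + block_start L) ` edge_cells L L"
  have fin: "finite ?A" using finite_edge_cells[OF L] by simp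
  have "(\<integral>\<^sup>+x. epowr (ennreal \<bar>edge_indicator L x\<bar>) p * ennreal (majorant p x) \<partial>lborel)
     \<le> (\<integral>\<^sup>+x. ennreal (13 powr p * glued_cell \<lfloor>x\<rfloor>) * indicator {x. \<lfloor>x\<rfloor> \<in> ?A} (x::real) \<partial>lborel)"
  proof (rule nn_integral_mono)
    fix x :: real
    have "ennreal (majorant p x) \<le> ennreal (13 powr p * glued_cell \<lfloor>x\<rfloor>)" using majorant_le[OF p, of x] by (intro ennreal_leI) (simp add: glued_def)
    then show "epowr (ennreal \<bar>edge_indicator L x\<bar>) p * ennreal (majorant p x) \<le> ennreal (13 powr p * glued_cell \<lfloor>x\<rfloor>) * indicator {x. \<lfloor>x\<rfloor> \<in> ?A} x"
      using p by (auto simp: edge_indicator_def step_indicator_def epowr_def)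
  qed
  also have "\<dots> = (\<Sum>c\<in>?A. ennreal (13 powr p * glued_cell c))"
    by (rule nn_integral_cells[of ?A "\<lambda>c. 13 powr p * glued_cell c", OF fin])
  also have "\<dots> = ennreal (\<Sum>c\<in>?A. 13 powr p * glued_cell c)" by (rule sum_ennreal) (simp add: glued_cell_nonneg)
  also have "(\<Sum>c\<in>?A. 13 powr p * glued_cell c) = (\<Sum>c\<in>edge_cells L L. 13 powr p * (2 ^ L * cell_weight L L c))"
    unfolding shifted_cell_sum using edge_cells_bound[OF L, of L] by (intro sum.cong refl) (auto simp: glued_cell_on_block[OF L])
  also have "\<dots> = 13 powr p * (2 ^ L * (\<Sum>c\<in>edge_cells L L. cell_weight L L c))" by (simp add: sum_distrib_left)
  also have "\<dots> \<le> 13 powr p * (2 ^ L * (2 * real L ^ L))"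
  proof (intro mult_left_mono)
    have "(\<Sum>c\<in>edge_cells L L. cell_weight L L c) \<le> (\<Sum>c\<in>{0..<side L L}. cell_weight L L c)"
      using edge_cells_bound[OF L] by (intro sum_mono2) (auto simp: cell_weight_nonneg)
    also have "\<dots> \<le> 2 * real L ^ L" using L by (simp add: cell_weight_mass[OF L])
    finally show "(\<Sum>c\<in>edge_cells L L. cell_weight L L c) \<le> 2 * real L ^ L" .
  qed auto
  finally show ?thesis by (simp add: ennreal_leI)
qed

text \<open>
  An edge cell within distance 1 of a full cell would contradict cell_weight_nearby: no greater
  density occurs within distance 1 of a plateau.
\<close>
lemma far_cells:
  assumes L: "4 \<le> L" and c: "c \<in> full_cells L k" and e: "e \<in> edge_cells L k"
  shows "2 \<le> \<bar>e - c\<bar>"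
proof (rule ccontr)
  assume "\<not> 2 \<le> \<bar>e - c\<bar>"
  then have "\<bar>c - e\<bar> \<le> 1" by linarith
  have "cell_weight L k e \<noteq> 0" "cell_weight L k e \<noteq> 1" using e by (auto simp: edge_cells_def)
  then obtain j where j: "cell_weight L k e = (1/2) ^ Suc j" using cell_weight_values by blast
  have "1 \<le> side L j" using side_pos[OF L, of j] by linarith
  then have "cell_weight L k c \<le> cell_weight L k e" using \<open>\<bar>c - e\<bar> \<le> 1\<close> by (intro cell_weight_nearby[OF L j]) linarith
  then show False using c e by (simp add: full_cells_def edge_cells_def)
qed

text \<open>
  A substitute for the inequality of Jensen: it bounds a p-th power from below by an affine function
  of t, so that a bound for a sum of values gives one for the sum of their p-th powers.
\<close>
lemma powr_ge_affine:
  fixes t b p :: real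
  assumes p: "1 < p" and b: "0 < b" and t: "0 \<le> t"
  shows "b powr (p - 1) * t - b powr p \<le> t powr p"
proof (cases "t \<le> b")
  case True
  then have "b powr (p - 1) * t \<le> b powr (p - 1) * b" by (intro mult_left_mono) auto
  also have "\<dots> = b powr p" using b by (simp add: powr_diff)
  finally show ?thesis using powr_ge_zero[of t p] by linarith
next
  case False
  then have "b powr (p - 1) * t \<le> t powr (p - 1) * t" using b p by (intro mult_right_mono powr_mono2) auto
  also have "\<dots> = t powr p" using b False by (simp add: powr_diff)
  finally show ?thesis using powr_ge_zero[of b p] by linarith
qed

text \<open>
  Over the full cells the average of |Hf| is at least 2 b, and at t = 2 b the affine minorant of
  powr_ge_affine takes the value b^p.
\<close>
lemma glued_integral_hilbert_edge_indicator:
  assumes L: "4 \<le> L" and p: "1 < p" and gain: "8 < gain L"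
  shows "ennreal (2 ^ L * (real L ^ L * ((gain L - 8) / 2) powr p))
    \<le> (\<integral>\<^sup>+x. epowr (ennreal \<bar>hilbert (edge_indicator L) x\<bar>) p * ennreal (glued x) \<partial>lborel)"
proof -
  let ?A = "(\<lambda>c. c + block_start L) ` edge_cells L L" and ?B = "(\<lambda>c. c + block_start L) ` full_cells L L"
  define b where "b = (gain L - 8) / 2"
  have b: "0 < b" using gain by (simp add: b_def)
  define G where "G c = (\<Sum>e\<in>?A. 1 / real_of_int (e - c - 1))" for c
  define \<phi> where "\<phi> c = 2 ^ L * (b powr (p - 1) * (- G c) - b powr p)" for c
  have finA: "finite ?A" using finite_edge_cells[OF L] by simp
  have finB: "finite ?B" using finite_full_cells[OF L] by simp
  have "2 ^ L * (real L ^ L * b powr p) \<le> (\<Sum>c\<in>?B. \<phi> c)"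
  proof -
    have "(\<Sum>c\<in>?B. G c) = pairing L L 0"
      unfolding pairing_def G_def shifted_cell_sum by (simp add: algebra_simps)
    moreover have "2 * b = gain L - 8" by (simp add: b_def)
    ultimately have "(\<Sum>c\<in>?B. G c) \<le> - (real L ^ L * (2 * b))" using pairing_top[OF L] by (simp only:)
    then have "b powr (p - 1) * (real L ^ L * (2 * b)) \<le> b powr (p - 1) * - (\<Sum>c\<in>?B. G c)"
      by (intro mult_left_mono) auto
    moreover have "b powr (p - 1) * (real L ^ L * (2 * b)) = 2 * (real L ^ L * b powr p)"
      using b by (simp add: powr_diff)
    ultimately have "real L ^ L * b powr p \<le> b powr (p - 1) * - (\<Sum>c\<in>?B. G c) - real L ^ L * b powr p"
      by linarith
    moreover have "real (card ?B) = real L ^ L" using card_full_cells[OF L, of L] by (subst card_image) (auto simp: inj_on_def)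
    moreover have "(\<Sum>c\<in>?B. \<phi> c) = 2 ^ L * (b powr (p - 1) * - (\<Sum>c\<in>?B. G c) - real (card ?B) * b powr p)"
      by (simp only: \<phi>_def sum_distrib_left[symmetric] sum_subtractf sum_negf sum_constant)
    ultimately show ?thesis by simp
  qed
  also have "(\<Sum>c\<in>?B. \<phi> c) \<le> (\<Sum>c\<in>?B. max 0 (\<phi> c))" by (rule sum_mono) simp
  finally have "ennreal (2 ^ L * (real L ^ L * b powr p)) \<le> ennreal (\<Sum>c\<in>?B. max 0 (\<phi> c))"
    by (rule ennreal_leI)
  also have "\<dots> = (\<Sum>c\<in>?B. ennreal (max 0 (\<phi> c)))" by (rule sum_ennreal[symmetric]) simp
  also have "\<dots> = (\<integral>\<^sup>+x. ennreal (max 0 (\<phi> \<lfloor>x\<rfloor>)) * indicator {x. \<lfloor>x\<rfloor> \<in> ?B} (x::real) \<partial>lborel)"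
    by (rule nn_integral_cells[of ?B "\<lambda>c. max 0 (\<phi> c)", OF finB, symmetric])
  also have "\<dots> \<le> (\<integral>\<^sup>+x. epowr (ennreal \<bar>hilbert (edge_indicator L) x\<bar>) p * ennreal (glued x) \<partial>lborel)"
  proof (rule nn_integral_mono)
    fix x :: real
    show "ennreal (max 0 (\<phi> \<lfloor>x\<rfloor>)) * indicator {x. \<lfloor>x\<rfloor> \<in> ?B} x \<le> epowr (ennreal \<bar>hilbert (edge_indicator L) x\<bar>) p * ennreal (glued x)"
    proof (cases "\<lfloor>x\<rfloor> \<in> ?B")
      case True
      then obtain c where c: "c \<in> full_cells L L" "\<lfloor>x\<rfloor> = c + block_start L" by auto
      define h where "h = hilbert (edge_indicator L) x"
      have "h \<le> G \<lfloor>x\<rfloor>"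
        unfolding h_def edge_indicator_def G_def using far_cells[OF L c(1)] c(2)
        by (intro hilbert_step_le[OF finA]) auto
      then have hG: "- G \<lfloor>x\<rfloor> \<le> \<bar>h\<bar>" by linarith
      have gx: "glued x = 2 ^ L"
        using c(1) subsetD[OF full_cells_bound[OF L] c(1)] unfolding glued_def c(2) by (simp add: glued_cell_on_block[OF L] full_cells_def)
      have "b powr (p - 1) * (- G \<lfloor>x\<rfloor>) - b powr p \<le> b powr (p - 1) * \<bar>h\<bar> - b powr p"
        using hG by (intro diff_right_mono mult_left_mono) auto
      also have "\<dots> \<le> \<bar>h\<bar> powr p" by (rule powr_ge_affine[OF p b]) simp
      finally have "\<phi> \<lfloor>x\<rfloor> \<le> 2 ^ L * \<bar>h\<bar> powr p" unfolding \<phi>_def by (intro mult_left_mono) auto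
      then have "ennreal (max 0 (\<phi> \<lfloor>x\<rfloor>)) \<le> ennreal (\<bar>h\<bar> powr p * 2 ^ L)" by (intro ennreal_leI) (simp add: mult.commute)
      then show ?thesis using True gx by (simp add: epowr_ennreal h_def ennreal_mult[symmetric])
    qed simp
  qed
  finally show ?thesis by (simp add: b_def)
qed

lemma edge_indicator_in_Ldom:
  assumes L: "4 \<le> L" and p: "1 < p"
  shows "edge_indicator L \<in> Ldom p (\<lambda>x. ennreal (majorant p x))"
  unfolding Ldom_def
proof (intro CollectI conjI)
  show "edge_indicator L \<in> borel_measurable lebesgue"
    unfolding edge_indicator_def by (intro measurable_completion) measurable
  have "edge_indicator L x = 0" if "\<not> 0 < ennreal (majorant p x)" for x
  proof (rule ccontr)
    assume "edge_indicator L x \<noteq> 0"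
    then obtain c where c: "c \<in> edge_cells L L" "\<lfloor>x\<rfloor> = c + block_start L" by (auto simp: edge_indicator_def step_indicator_def split: if_splits)
    have "glued x = 2 ^ L * cell_weight L L c"
      using subsetD[OF edge_cells_bound[OF L] c(1)] unfolding glued_def c(2) by (simp add: glued_cell_on_block[OF L])
    then have "0 < glued x" using c(1) by (simp add: edge_cells_def)
    then show False using that majorant_pos_iff[OF p] by simp
  qed
  then show "AE x in lebesgue. \<not> 0 < ennreal (majorant p x) \<longrightarrow> edge_indicator L x = 0" by simp
  have "(\<integral>\<^sup>+x. epowr (ennreal \<bar>edge_indicator L x\<bar>) p * ennreal (majorant p x) \<partial>lborel) < \<infinity>"
    by (rule le_less_trans[OF majorant_integral_edge_indicator[OF L p]]) simp
  then show "Lnorm p (\<lambda>x. ennreal (majorant p x)) (\<lambda>x. ennreal \<bar>edge_indicator L x\<bar>) < \<infinity>"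
    by (simp add: Lnorm_def nn_integral_completion epowr_def)
qed

text \<open>
  Boundedness with constant c would imply b^p \<le> 2 (13 c)^p \<le> (26 c)^p for b = (gain L - 8)/2 and
  every L.
\<close>
lemma hilbert_unbounded:
  assumes p: "1 < p"
  shows "\<not> bounded_operator (\<lambda>f x. ennreal \<bar>hilbert f x\<bar>) p (\<lambda>x. ennreal (majorant p x)) (\<lambda>x. ennreal (glued x))"
proof
  assume "bounded_operator (\<lambda>f x. ennreal \<bar>hilbert f x\<bar>) p (\<lambda>x. ennreal (majorant p x)) (\<lambda>x. ennreal (glued x))"
  then obtain C where C: "C < \<infinity>" and bd: "\<And>f. f \<in> Ldom p (\<lambda>x. ennreal (majorant p x)) \<Longrightarrow>
     Lnorm p (\<lambda>x. ennreal (glued x)) (\<lambda>x. ennreal \<bar>hilbert f x\<bar>) \<le> C * Lnorm p (\<lambda>x. ennreal (majorant p x)) (\<lambda>x. ennreal \<bar>f x\<bar>)"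
    unfolding bounded_operator_def by blast
  obtain c where c: "0 \<le> c" "C = ennreal c" using C by (cases C) auto
  obtain L where L: "4 \<le> L" and gain: "8 + 2 * (26 * (c + 1)) \<le> gain L" using gain_unbounded by blast
  have g8: "8 < gain L" using gain c by simp
  define b where "b = (gain L - 8) / 2"
  have b: "26 * (c + 1) \<le> b" using gain by (simp add: b_def)
  define A where "A = (\<integral>\<^sup>+x. epowr (ennreal \<bar>hilbert (edge_indicator L) x\<bar>) p * ennreal (glued x) \<partial>lborel)"
  define B where "B = (\<integral>\<^sup>+x. epowr (ennreal \<bar>edge_indicator L x\<bar>) p * ennreal (majorant p x) \<partial>lborel)"
  have inv: "epowr (epowr X (1/p)) p = X" for X
    using p by (cases X) (auto simp: epowr_def powr_powr)
  have "epowr A (1/p) \<le> C * epowr B (1/p)"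
    using bd[OF edge_indicator_in_Ldom[OF L p]] by (simp add: Lnorm_def nn_integral_completion A_def B_def)
  then have "epowr (epowr A (1/p)) p \<le> epowr (C * epowr B (1/p)) p" using p by (intro epowr_mono) auto
  then have "A \<le> ennreal (c powr p) * B" using p c by (simp add: inv epowr_mult epowr_ennreal)
  also have "\<dots> \<le> ennreal (c powr p) * ennreal (13 powr p * (2 ^ L * (2 * real L ^ L)))"
    unfolding B_def by (intro mult_left_mono majorant_integral_edge_indicator[OF L p]) simp
  also have "\<dots> = ennreal (c powr p * (13 powr p * (2 ^ L * (2 * real L ^ L))))"
    by (simp add: ennreal_mult)
  finally have "ennreal (2 ^ L * (real L ^ L * b powr p)) \<le> ennreal (c powr p * (13 powr p * (2 ^ L * (2 * real L ^ L))))"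
    using glued_integral_hilbert_edge_indicator[OF L p g8] unfolding A_def b_def by (rule order_trans[rotated])
  then have "2 ^ L * (real L ^ L * b powr p) \<le> c powr p * (13 powr p * (2 ^ L * (2 * real L ^ L)))" by simp
  then have "(2 ^ L * real L ^ L) * b powr p \<le> (2 ^ L * real L ^ L) * (2 * (13 powr p * c powr p))" by (simp add: algebra_simps)
  then have "b powr p \<le> 2 * (13 powr p * c powr p)" using L by (subst (asm) mult_le_cancel_left_pos) auto
  also have "\<dots> \<le> 2 powr p * (13 powr p * c powr p)"
    using powr_mono[of 1 p 2] p by (intro mult_right_mono) auto
  also have "\<dots> = (26 * c) powr p" using c by (simp add: powr_mult[symmetric])
  also have "\<dots> < (26 * (c + 1)) powr p" using c p by (intro powr_less_mono2) auto
  also have "\<dots> \<le> b powr p" using b c p by (intro powr_mono2) auto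
  finally show False by simp
qed

lemma glued_nontrivial: "nontrivial glued"
  unfolding nontrivial_def
proof
  assume "AE x in lebesgue. glued x = 0"
  then have ae: "AE x in lborel. glued x = 0" by (simp add: AE_completion_iff)
  have "glued_cell (0 + block_start 4) = 2 ^ 4 * cell_weight 4 4 0" using side_pos[of 4 4] by (intro glued_cell_on_block) auto
  moreover have "cell_weight 4 (Suc 3) (0 * side 4 3 + 0) = (1/2) ^ Suc 3" using side_pos[of 4 3] by (subst cell_weight_block) auto
  then have "cell_weight 4 4 0 = (1/2) ^ 4" by (simp del: power_Suc)
  ultimately have g1: "glued_cell (block_start 4) = 1" by (simp add: power4_eq_xxxx)
  have "(\<integral>\<^sup>+y. ennreal (glued_cell \<lfloor>y\<rfloor>) * indicator {y. \<lfloor>y\<rfloor> \<in> {block_start 4}} (y::real) \<partial>lborel) = 1"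
    by (subst nn_integral_cells) (auto simp: g1)
  moreover have "(\<integral>\<^sup>+y. ennreal (glued_cell \<lfloor>y\<rfloor>) * indicator {y. \<lfloor>y\<rfloor> \<in> {block_start 4}} (y::real) \<partial>lborel) = (\<integral>\<^sup>+(y::real). 0 \<partial>lborel)"
    by (rule nn_integral_cong_AE) (use ae in eventually_elim, simp add: glued_def)
  ultimately show False by simp
qed

theorem theorem1p6:
  fixes p p' :: real
  assumes "1 < p" and "1 / p + 1 / p' = 1"
  shows "\<exists>w v :: real \<Rightarrow> real.
    weight w \<and> nontrivial w \<and> weight v \<and> nontrivial v \<and>
    (\<forall>x. ennreal (v x) =
       (if 0 < w x then epowr (maximal w x / ennreal (w x)) p * ennreal (w x) else 0)) \<and>
    bounded_operator maximal p (\<lambda>x. ennreal (v x)) (\<lambda>x. ennreal (w x)) \<and>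
    bounded_operator maximal p'
      (\<lambda>x. if 0 < w x then ennreal (w x powr (1 - p')) else 0)
      (\<lambda>x. if 0 < w x then ennreal (w x) / epowr (maximal w x) p' else 0) \<and>
    \<not> bounded_operator (\<lambda>f x. ennreal \<bar>hilbert f x\<bar>) p (\<lambda>x. ennreal (v x)) (\<lambda>x. ennreal (w x))"
proof (intro exI conjI allI)
  note p = assms(1)
  have "0 < 1 / p" "1 / p < 1" using p by auto
  then have "0 < 1 / p'" "1 / p' < 1" using assms(2) by linarith+
  then have p': "1 < p'" by (simp add: divide_less_eq split: if_splits)
  show "weight glued" by (rule weight_of_bound[of _ 1]) (auto simp: glued_nonneg)
  show "nontrivial glued" by (rule glued_nontrivial)
  show "weight (majorant p)" using majorant_le[OF p] by (intro weight_of_bound[of _ "13 powr p"]) (auto simp: majorant_nonneg)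
  show "nontrivial (majorant p)"
    unfolding nontrivial_def
  proof
    assume "AE x in lebesgue. majorant p x = 0"
    then have "AE x in lebesgue. glued x = 0"
      by eventually_elim (use majorant_pos_iff[OF p] glued_nonneg in \<open>metis less_eq_real_def less_irrefl\<close>)
    then show False using glued_nontrivial by (simp add: nontrivial_def)
  qed
  show "ennreal (majorant p x) = (if 0 < glued x then epowr (maximal glued x / ennreal (glued x)) p * ennreal (glued x) else 0)" for x
    by (rule majorant_eq[OF p])
  show "bounded_operator maximal p (\<lambda>x. ennreal (majorant p x)) (\<lambda>x. ennreal (glued x))"
    using majorant_ge[OF p] majorant_pos_iff[OF p] by (intro maximal_bounded_Fefferman_Stein[OF p] glued_nonneg) auto
  show "bounded_operator maximal p'
      (\<lambda>x. if 0 < glued x then ennreal (glued x powr (1 - p')) else 0)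
      (\<lambda>x. if 0 < glued x then ennreal (glued x) / epowr (maximal glued x) p' else 0)"
  proof (rule maximal_bounded_dual[OF p'])
    fix x assume w: "0 < glued x"
    have "0 < ennreal (glued x)" using w by simp
    also have "\<dots> \<le> maximal glued x" by (rule maximal_glued_ge)
    finally have "0 < maximal glued x" .
    moreover have "maximal glued x < \<infinity>" by (rule le_less_trans[OF maximal_glued_le[OF w]]) simp
    ultimately show "0 < maximal glued x \<and> maximal glued x < \<infinity>" by simp
  qed (auto simp: glued_nonneg glued_local_finite[unfolded infinity_ennreal_def])
  show "\<not> bounded_operator (\<lambda>f x. ennreal \<bar>hilbert f x\<bar>) p (\<lambda>x. ennreal (majorant p x)) (\<lambda>x. ennreal (glued x))"
    by (rule hilbert_unbounded[OF p])
qed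

end
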